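(* Suppose $\Sigma=\Omega\otimes\Phi$, where $\Omega$ ($2\times 2$) and $\Phi$ ($k\times k$) are symmetric positive definite. Let $h_1(s,t)$ and $h_2(s,t)$ be the MM1 and MM2 weighted-average densities defined in the context, formed with these $\Omega$ and $\Phi$. Then: (i) $h_1(s,t)$ and $h_2(s,t)$ are invariant to the orthogonal transformations $(s,t)\mapsto(gs,gt)$, $g\in\mathcal{O}_k$. That is, they depend on $(s,t)$ only through $(q_S,q_{ST},q_T)=(s's,\,s't,\,t't)$. (ii) $h_2(s,t)$ is invariant to the sign transformation $(q_S,q_{ST},q_T)\mapsto(q_S,-q_{ST},q_T)$. That is, it depends on $(s,t)$ only through $q_S$, $|q_{ST}|$ and $q_T$.
   Context: Fix $k\ge1$, $\beta_0\in\mathbb{R}$ and a symmetric positive definite $2k\times 2k$ matrix $\Sigma$. For $\beta\in\mathbb{R}$ write $a=(\beta,1)'$, $a_0=(\beta_0,1)'$, $b_0=(1,-\beta_0)'$. Powers of positive definite matrices are symmetric positive definite. Define $$C_{\beta_0}=[(b_0'\otimes I_k)\Sigma(b_0\otimes I_k)]^{-1/2},\qquad D_\beta=[(a_0'\otimes I_k)\Sigma^{-1}(a_0\otimes I_k)]^{-1/2}(a_0'\otimes I_k)\Sigma^{-1}(a\otimes I_k).$$ For $\mu\in\mathbb{R}^k$, let $f_{\beta,\mu}(s,t)$ be the joint density at $(s,t)\in\mathbb{R}^k\times\mathbb{R}^k$ of independent $S\sim N((\beta-\beta_0)C_{\beta_0}\mu,I_k)$ and $T\sim N(D_\beta\mu,I_k)$.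 For a probability measure $\Lambda$ on $(\beta,\mu)$ set $h_\Lambda(s,t)=\int f_{\beta,\mu}(s,t)\,d\Lambda(\beta,\mu)$. $\mathcal{O}_k$ is the group of $k\times k$ orthogonal matrices. MM1: $h_1=h_\Lambda$, where under $\Lambda$, $\beta\sim N(\beta_0,1)$ and $\mu\sim N(0,\sigma^2\Phi)$ are independent, with $\sigma^2>0$ a fixed constant. MM2: let $$c_\beta=(\beta-\beta_0)(b_0'\Omega b_0)^{-1/2},\qquad d_\beta=a'\Omega^{-1}a_0\,(a_0'\Omega^{-1}a_0)^{-1/2},\qquad l_\beta=(c_\beta,d_\beta)'.$$ For all but finitely many $\theta\in[-\pi,\pi]$ ($\pi=3.1415\ldots$) let $\beta(\theta)$ be the value of $\beta$ determined by $\tan\theta=d_{\beta}/c_{\beta}$. Then $h_2=h_\Lambda$, where $\Lambda$ is the law of $(\beta(\theta),\mu)$ with $\theta\sim\mathrm{Unif}[-\pi,\pi]$ and $\mu\mid\theta\sim N(0,\|l_{\beta(\theta)}\|^{-2}\zeta\,\Phi)$, with $\zeta>0$ a fixed constant. *)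

theory Defs
  imports "HOL-Probability.Probability"
begin

definition sym_pos_def :: "real ^ 'n ^ 'n \<Rightarrow> bool" where
  "sym_pos_def A \<longleftrightarrow> transpose A = A \<and> (\<forall>x. x \<noteq> 0 \<longrightarrow> 0 < x \<bullet> (A *v x))"

(* A^(-1/2): the symmetric positive definite square root of the inverse of A;
   it exists and is unique whenever A is symmetric positive definite. *)
definition mat_inv_sqrt :: "real ^ 'n ^ 'n \<Rightarrow> real ^ 'n ^ 'n" where
  "mat_inv_sqrt A = (THE B. sym_pos_def B \<and> B ** B = matrix_inv A)"

(* Row (i, p) stands for row (i - 1) * CARD('m) + p: the first component of an index
   selects the block, the second one the position inside the block. *)
definition kron :: "real ^ 'b ^ 'a \<Rightarrow> real ^ 'n ^ 'm \<Rightarrow> real ^ ('b \<times> 'n) ^ ('a \<times> 'm)" where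
  "kron A B = (\<chi> i j. A $ fst i $ fst j * B $ snd i $ snd j)"

(* The Kronecker product of the column vector a, read as a one-column matrix, with B;
   the column index 1 \<times> 'n is identified with 'n. *)
definition kron_col :: "real ^ 'a \<Rightarrow> real ^ 'n ^ 'm \<Rightarrow> real ^ 'n ^ ('a \<times> 'm)" where
  "kron_col a B = (\<chi> i j. a $ fst i * B $ snd i $ j)"

(* The vectors a = (\<beta>, 1)' (so that a_0 is a_vec \<beta>0) and b_0 = (1, -\<beta>0)'. *)
definition a_vec :: "real \<Rightarrow> real ^ 2" where
  "a_vec \<beta> = vector [\<beta>, 1]"

definition b_vec :: "real \<Rightarrow> real ^ 2" where
  "b_vec \<beta> = vector [1, - \<beta>]"

definition C_mat :: "real \<Rightarrow> real ^ (2 \<times> 'k::finite) ^ (2 \<times> 'k) \<Rightarrow> real ^ 'k ^ 'k" where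
  "C_mat \<beta>0 \<Sigma> =
     mat_inv_sqrt (transpose (kron_col (b_vec \<beta>0) (mat 1)) ** \<Sigma> ** kron_col (b_vec \<beta>0) (mat 1))"

definition D_mat :: "real \<Rightarrow> real ^ (2 \<times> 'k::finite) ^ (2 \<times> 'k) \<Rightarrow> real \<Rightarrow> real ^ 'k ^ 'k" where
  "D_mat \<beta>0 \<Sigma> \<beta> =
     mat_inv_sqrt (transpose (kron_col (a_vec \<beta>0) (mat 1)) ** matrix_inv \<Sigma> ** kron_col (a_vec \<beta>0) (mat 1))
     ** (transpose (kron_col (a_vec \<beta>0) (mat 1)) ** matrix_inv \<Sigma> ** kron_col (a_vec \<beta>) (mat 1))"

(* Density and law of the multivariate normal distribution N(m, V), V positive definite. *)
definition mvn_density :: "real ^ 'n \<Rightarrow> real ^ 'n ^ 'n \<Rightarrow> real ^ 'n \<Rightarrow> real" where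
  "mvn_density m V x =
     exp (- ((x - m) \<bullet> (matrix_inv V *v (x - m))) / 2) / sqrt ((2 * pi) ^ CARD('n) * det V)"

definition mvn :: "real ^ 'n \<Rightarrow> real ^ 'n ^ 'n \<Rightarrow> (real ^ 'n) measure" where
  "mvn m V = density lborel (mvn_density m V)"

definition joint_density ::
  "real \<Rightarrow> real ^ (2 \<times> 'k::finite) ^ (2 \<times> 'k) \<Rightarrow> real \<Rightarrow> real ^ 'k \<Rightarrow> real ^ 'k \<Rightarrow> real ^ 'k \<Rightarrow> real" where
  "joint_density \<beta>0 \<Sigma> \<beta> \<mu> s t =
     mvn_density ((\<beta> - \<beta>0) *\<^sub>R (C_mat \<beta>0 \<Sigma> *v \<mu>)) (mat 1) s
     * mvn_density (D_mat \<beta>0 \<Sigma> \<beta> *v \<mu>) (mat 1) t"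

definition weighted_density ::
  "real \<Rightarrow> real ^ (2 \<times> 'k::finite) ^ (2 \<times> 'k) \<Rightarrow> (real \<times> (real ^ 'k)) measure
    \<Rightarrow> real ^ 'k \<Rightarrow> real ^ 'k \<Rightarrow> real" where
  "weighted_density \<beta>0 \<Sigma> \<Lambda> s t = (\<integral>(\<beta>, \<mu>). joint_density \<beta>0 \<Sigma> \<beta> \<mu> s t \<partial>\<Lambda>)"

definition MM1_law :: "real \<Rightarrow> real ^ 'k ^ 'k \<Rightarrow> real \<Rightarrow> (real \<times> (real ^ 'k)) measure" where
  "MM1_law \<beta>0 \<Phi> \<sigma> = density lborel (normal_density \<beta>0 1) \<Otimes>\<^sub>M mvn 0 (\<sigma>\<^sup>2 *\<^sub>R \<Phi>)"

definition h_MM1 ::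
  "real \<Rightarrow> real ^ (2 \<times> 'k::finite) ^ (2 \<times> 'k) \<Rightarrow> real ^ 'k ^ 'k \<Rightarrow> real
    \<Rightarrow> real ^ 'k \<Rightarrow> real ^ 'k \<Rightarrow> real" where
  "h_MM1 \<beta>0 \<Sigma> \<Phi> \<sigma> = weighted_density \<beta>0 \<Sigma> (MM1_law \<beta>0 \<Phi> \<sigma>)"

definition c_coef :: "real \<Rightarrow> real ^ 2 ^ 2 \<Rightarrow> real \<Rightarrow> real" where
  "c_coef \<beta>0 \<Omega> \<beta> = (\<beta> - \<beta>0) * (b_vec \<beta>0 \<bullet> (\<Omega> *v b_vec \<beta>0)) powr (- 1 / 2)"

definition d_coef :: "real \<Rightarrow> real ^ 2 ^ 2 \<Rightarrow> real \<Rightarrow> real" where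
  "d_coef \<beta>0 \<Omega> \<beta> =
     (a_vec \<beta> \<bullet> (matrix_inv \<Omega> *v a_vec \<beta>0))
     * (a_vec \<beta>0 \<bullet> (matrix_inv \<Omega> *v a_vec \<beta>0)) powr (- 1 / 2)"

definition l_vec :: "real \<Rightarrow> real ^ 2 ^ 2 \<Rightarrow> real \<Rightarrow> real ^ 2" where
  "l_vec \<beta>0 \<Omega> \<beta> = vector [c_coef \<beta>0 \<Omega> \<beta>, d_coef \<beta>0 \<Omega> \<beta>]"

(* The conjunct c \<noteq> 0 keeps the convention d / 0 = 0 from adding the solution \<beta> = \<beta>0.
   For positive definite \<Omega>, d / c is of the form p + q / (\<beta> - \<beta>0) with q > 0, so \<beta> is uniquely
   determined except when tan \<theta> = p.  These exceptional \<theta> in [-pi, pi], together with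
   \<theta> = pi / 2 and \<theta> = - pi / 2 (where tan \<theta> = 0 by convention), are finitely many, so the
   value there is irrelevant for the law of \<beta>. *)
definition beta_of :: "real \<Rightarrow> real ^ 2 ^ 2 \<Rightarrow> real \<Rightarrow> real" where
  "beta_of \<beta>0 \<Omega> \<theta> =
     (THE \<beta>. c_coef \<beta>0 \<Omega> \<beta> \<noteq> 0 \<and> tan \<theta> = d_coef \<beta>0 \<Omega> \<beta> / c_coef \<beta>0 \<Omega> \<beta>)"

definition MM2_law ::
  "real \<Rightarrow> real ^ 2 ^ 2 \<Rightarrow> real ^ 'k ^ 'k \<Rightarrow> real \<Rightarrow> (real \<times> (real ^ 'k)) measure" where
  "MM2_law \<beta>0 \<Omega> \<Phi> \<zeta> = do {
     \<theta> \<leftarrow> uniform_measure lborel {- pi..pi};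
     \<mu> \<leftarrow> mvn 0 ((\<zeta> / (norm (l_vec \<beta>0 \<Omega> (beta_of \<beta>0 \<Omega> \<theta>)))\<^sup>2) *\<^sub>R \<Phi>);
     return (borel \<Otimes>\<^sub>M borel) (beta_of \<beta>0 \<Omega> \<theta>, \<mu>)
   }"

definition h_MM2 ::
  "real \<Rightarrow> real ^ (2 \<times> 'k::finite) ^ (2 \<times> 'k) \<Rightarrow> real ^ 2 ^ 2 \<Rightarrow> real ^ 'k ^ 'k \<Rightarrow> real
    \<Rightarrow> real ^ 'k \<Rightarrow> real ^ 'k \<Rightarrow> real" where
  "h_MM2 \<beta>0 \<Sigma> \<Omega> \<Phi> \<zeta> = weighted_density \<beta>0 \<Sigma> (MM2_law \<beta>0 \<Omega> \<Phi> \<zeta>)"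

end

theory Submission
  imports Defs
begin

text \<open>For \<open>\<Sigma> = \<Omega> \<otimes> \<Phi>\<close> the Kronecker structure gives \<open>(\<beta> - \<beta>\<^sub>0) C \<mu> = c\<^sub>\<beta> \<Phi>\<^sup>-\<^sup>1\<^sup>/\<^sup>2 \<mu>\<close> and
  \<open>D\<^sub>\<beta> \<mu> = d\<^sub>\<beta> \<Phi>\<^sup>-\<^sup>1\<^sup>/\<^sup>2 \<mu>\<close> (\<open>joint_density_kron\<close>). When \<open>\<mu>\<close> is normal with covariance a multiple of \<open>\<Phi>\<close>, the
  vector \<open>\<Phi>\<^sup>-\<^sup>1\<^sup>/\<^sup>2 \<mu>\<close> is a multiple of a standard normal vector \<open>w\<close> (\<open>mvn_eq_distr_std_mvn\<close>). Both
  weighted averages are therefore mixtures, over scalars \<open>(c, d)\<close>, of the average of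
  \<open>\<phi>(s - c w) \<phi>(t - d w)\<close> over \<open>w\<close>. Expanding the squares, this average is an explicit function of
  \<open>s \<bullet> s + t \<bullet> t\<close> times the mean of \<open>exp ((c s + d t) \<bullet> w - (c\<^sup>2 + d\<^sup>2) (w \<bullet> w) / 2)\<close>, and the law of \<open>w\<close> is
  rotation invariant, so that only the norm of \<open>c s + d t\<close> matters. Thus the average depends only on
  \<open>c\<^sup>2\<close>, \<open>d\<^sup>2\<close>, \<open>s \<bullet> s\<close>, \<open>t \<bullet> t\<close> and \<open>c d (s \<bullet> t)\<close> (\<open>std_mixture_cong\<close>). Part (i) follows at once.

  For MM2 the pair \<open>(c, d)\<close> is \<open>\<surd>\<zeta> l\<^sub>\<beta> / \<parallel>l\<^sub>\<beta>\<parallel>\<close>, which by the choice of \<open>\<beta>(\<theta>)\<close> equals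
  \<open>\<plusminus>\<surd>\<zeta> (cos \<theta>, sin \<theta>)\<close> for almost every \<open>\<theta>\<close>; a common sign changes neither the squares nor the
  product. So \<open>\<theta>\<close> runs uniformly over the circle (\<open>h_MM2_eq\<close>), and the reflection \<open>\<theta> \<mapsto> -\<theta>\<close> flips the
  sign of \<open>c d\<close>, which amounts to flipping that of \<open>s \<bullet> t\<close>. This is part (ii).

  The inverse square roots are handled by a spectral theorem for symmetric matrices. The
  substitutions in the normal integrals rest on the invariance of Lebesgue measure under orthogonal
  maps, which is derived from the uniqueness of translation-invariant measures; diagonalization then
  gives the substitution rule for positive definite maps.\<close>

section \<open>Spectral theorem and square roots of positive definite matrices\<close>

lemma matrix_inv_eqI:
  fixes A B :: "real ^ 'n ^ 'n"
  assumes "A ** B = mat 1"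
  shows "matrix_inv A = B"
proof -
  have BA: "B ** A = mat 1"
    using assms matrix_left_right_inverse by blast
  have "A ** matrix_inv A = mat 1 \<and> matrix_inv A ** A = mat 1"
    unfolding matrix_inv_def by (rule someI[of _ B]) (use assms BA in auto)
  then show ?thesis
    by (metis BA matrix_mul_assoc matrix_mul_lid matrix_mul_rid)
qed

lemma inner_symmetric_matrix:
  fixes A :: "real ^ 'n ^ 'n"
  assumes "transpose A = A"
  shows "x \<bullet> (A *v y) = (A *v x) \<bullet> y"
  by (metis assms dot_lmul_matrix transpose_matrix_vector)

lemma sym_pos_def_inner: "sym_pos_def A \<Longrightarrow> x \<bullet> (A *v y) = (A *v x) \<bullet> y"
  by (simp add: sym_pos_def_def inner_symmetric_matrix)

lemma sym_pos_def_pos: "sym_pos_def A \<Longrightarrow> x \<noteq> 0 \<Longrightarrow> 0 < x \<bullet> (A *v x)"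
  by (simp add: sym_pos_def_def)

lemma sym_pos_def_scaleR: "sym_pos_def A \<Longrightarrow> 0 < r \<Longrightarrow> sym_pos_def (r *\<^sub>R A)"
  by (simp add: sym_pos_def_def transpose_scalar scaleR_matrix_vector_assoc[symmetric]) 

text \<open>A maximizer \<open>v\<close> of the quadratic form on the unit sphere of \<open>S\<close> is an eigenvector. With \<open>l\<close> the
  maximum, the form \<open>Q x = l (x \<bullet> x) - x \<bullet> A x\<close> is nonnegative on \<open>S\<close> and vanishes at \<open>v\<close>; if the
  residual \<open>w = l v - A v\<close> were nonzero, moving from \<open>v\<close> a little against \<open>w\<close> would make \<open>Q\<close>
  negative.\<close>

lemma symmetric_has_eigenvector:
  fixes A :: "real ^ 'n ^ 'n"
  assumes sym: "transpose A = A" and S: "subspace S" "S \<noteq> {0}"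
    and inv: "\<And>x. x \<in> S \<Longrightarrow> A *v x \<in> S"
  obtains v l where "v \<in> S" "norm v = 1" "A *v v = l *\<^sub>R v"
proof -
  obtain y where y: "y \<in> S" "y \<noteq> 0"
    using S subspace_0 by blast
  have comp: "compact (S \<inter> sphere 0 1)"
    by (intro closed_Int_compact closed_subspace S compact_sphere)
  have ne: "S \<inter> sphere 0 1 \<noteq> {}"
  proof -
    have "y /\<^sub>R norm y \<in> S \<inter> sphere 0 1"
      using y S by (simp add: subspace_mul)
    then show ?thesis by blast
  qed
  have "continuous_on (S \<inter> sphere 0 1) (\<lambda>x. x \<bullet> (A *v x))"
    by (intro continuous_intros)
  from continuous_attains_sup[OF comp ne this]
  obtain v where v: "v \<in> S" "norm v = 1"
    and max: "\<And>x. x \<in> S \<Longrightarrow> norm x = 1 \<Longrightarrow> x \<bullet> (A *v x) \<le> v \<bullet> (A *v v)"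
    by auto
  define l where "l = v \<bullet> (A *v v)"
  define Q where "Q x = l * (x \<bullet> x) - x \<bullet> (A *v x)" for x
  have Q_nonneg: "0 \<le> Q x" if "x \<in> S" for x
  proof (cases "x = 0")
    case False
    have "(x /\<^sub>R norm x) \<bullet> (A *v (x /\<^sub>R norm x)) \<le> l"
      unfolding l_def by (rule max) (use that False S in \<open>auto simp: subspace_mul\<close>)
    then have "x \<bullet> (A *v x) / (norm x)\<^sup>2 \<le> l"
      by (simp add: matrix_vector_mult_scaleR power2_eq_square divide_inverse mult_ac)
    then show ?thesis
      using False by (simp add: Q_def pos_divide_le_eq dot_square_norm)
  qed (simp add: Q_def)
  define w where "w = l *\<^sub>R v - A *v v"
  have wS: "w \<in> S"
    unfolding w_def by (intro subspace_diff subspace_mul S v inv)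
  have Q_line: "Q (v + t *\<^sub>R w) = 2 * t * (w \<bullet> w) + t\<^sup>2 * Q w" for t
  proof -
    have "Q (v + t *\<^sub>R w) = Q v + 2 * t * (l * (w \<bullet> v) - w \<bullet> (A *v v)) + t\<^sup>2 * Q w"
      using inner_symmetric_matrix[OF sym, of v w] 
      by (simp add: Q_def matrix_vector_right_distrib matrix_vector_mult_scaleR inner_simps
          algebra_simps power2_eq_square inner_commute)
    moreover have "Q v = 0"
      using v by (simp add: Q_def l_def dot_square_norm)
    moreover have "l * (w \<bullet> v) - w \<bullet> (A *v v) = w \<bullet> w"
      by (simp add: w_def inner_simps)
    ultimately show ?thesis by simp
  qed
  have "w = 0"
  proof (rule ccontr)
    assume "w \<noteq> 0"
    then have ww: "0 < w \<bullet> w" by simp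
    \<comment> \<open>Along \<open>v - T w\<close> the form is \<open>T (T Q w - 2 (w \<bullet> w))\<close>; this \<open>T\<close> keeps \<open>T Q w \<le> w \<bullet> w\<close>.\<close>
    define T where "T = (w \<bullet> w) / (Q w + 1)"
    have Qw: "0 \<le> Q w" by (rule Q_nonneg[OF wS])
    then have T: "0 < T" "T * Q w \<le> w \<bullet> w"
      using ww by (simp_all add: T_def field_simps)
    have "0 \<le> Q (v + (- T) *\<^sub>R w)"
      by (intro Q_nonneg subspace_add subspace_mul S v wS)
    also have "\<dots> = T * (T * Q w - 2 * (w \<bullet> w))"
      unfolding Q_line by (simp add: algebra_simps power2_eq_square)
    also have "\<dots> < 0"
      using T ww by (intro mult_pos_neg) linarith+
    finally show False by simp
  qed
  then show ?thesis
    using that[of v l] v by (simp add: w_def)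
qed

text \<open>Symmetry makes the orthogonal complement of an eigenvector inside an invariant subspace invariant
  again, so eigenvectors can be split off one at a time. The statement is about invariant
  subspaces \<open>S\<close> only to make this induction on the dimension possible.\<close>

lemma symmetric_has_orthonormal_eigenbasis:
  fixes A :: "real ^ 'n ^ 'n"
  assumes sym: "transpose A = A" and "subspace S" "\<And>x. x \<in> S \<Longrightarrow> A *v x \<in> S"
  shows "\<exists>E. pairwise orthogonal E \<and> span E = S \<and>
    (\<forall>e\<in>E. norm e = 1 \<and> (\<exists>l. A *v e = l *\<^sub>R e))"
  using assms(2-)
proof (induction "dim S" arbitrary: S rule: less_induct)
  case less
  show ?case
  proof (cases "S = {0}")
    case True
    then show ?thesis by (intro exI[of _ "{}"]) auto
  next
    case False
    obtain v l where v: "v \<in> S" "norm v = 1" "A *v v = l *\<^sub>R v"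
      using symmetric_has_eigenvector[OF sym less.prems(1) False less.prems(2)] by blast
    define S' where "S' = S \<inter> {x. v \<bullet> x = 0}"
    have S': "subspace S'"
      unfolding S'_def by (intro subspace_inter less.prems subspace_hyperplane)
    have inv: "A *v x \<in> S'" if "x \<in> S'" for x
      using that less.prems(2)[of x] inner_symmetric_matrix[OF sym, of v x] v(3)
      by (simp add: S'_def)
    have "v \<notin> S'"
      using v(2) by (auto simp: S'_def)
    moreover have "S' \<subseteq> S" by (simp add: S'_def)
    ultimately have "dim S' \<noteq> dim S"
      using subspace_dim_equal[OF S' less.prems(1)] v(1) by auto
    moreover have "dim S' \<le> dim S"
      by (rule dim_subset) (auto simp: S'_def)
    ultimately obtain E where E: "pairwise orthogonal E" "span E = S'"
      "\<forall>e\<in>E. norm e = 1 \<and> (\<exists>l. A *v e = l *\<^sub>R e)"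
      using less.hyps[of S'] S' inv by force
    have ES': "E \<subseteq> S'" using E(2) span_superset by blast
    have "span (insert v E) = S"
    proof
      show "span (insert v E) \<subseteq> S"
        using ES' v(1) less.prems(1) by (intro span_minimal) (auto simp: S'_def)
      show "S \<subseteq> span (insert v E)"
      proof
        fix x assume x: "x \<in> S"
        have "x - (v \<bullet> x) *\<^sub>R v \<in> S'"
          using x v less.prems(1)
          by (auto simp: S'_def inner_simps dot_square_norm intro!: subspace_diff subspace_mul)
        then show "x \<in> span (insert v E)"
          using E(2) span_breakdown_eq by blast
      qed
    qed
    moreover have "pairwise orthogonal (insert v E)"
      using E(1) ES' by (auto simp: pairwise_insert S'_def orthogonal_def inner_commute)
    ultimately show ?thesis
      using E(3) v by (intro exI[of _ "insert v E"]) auto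
  qed
qed

definition diag_mat :: "('n \<Rightarrow> real) \<Rightarrow> real ^ 'n ^ 'n" where
  "diag_mat d = (\<chi> i j. if i = j then d i else 0)"

lemma diag_mat_mult: "diag_mat d ** diag_mat e = diag_mat (\<lambda>i. d i * e i)"
  by (simp add: diag_mat_def matrix_matrix_mult_def vec_eq_iff if_distrib[of "\<lambda>x. x * _"]
      if_distrib[of "\<lambda>x. _ * x"] cong: if_cong)

lemma diag_mat_one: "diag_mat (\<lambda>i. 1) = mat 1"
  by (simp add: diag_mat_def mat_def)

lemma diag_mat_vector: "(diag_mat d *v x) $ i = d i * x $ i"
  by (simp add: diag_mat_def matrix_vector_mult_def if_distrib[of "\<lambda>x. x * _"] cong: if_cong)

lemma transpose_diag_mat: "transpose (diag_mat d) = diag_mat d"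
  by (auto simp: diag_mat_def transpose_def vec_eq_iff)

lemma det_diag_mat: "det (diag_mat d) = (\<Prod>i\<in>UNIV. d i)"
  by (subst det_diagonal) (auto simp: diag_mat_def)

lemma symmetric_orthogonal_diagonalization:
  fixes A :: "real ^ 'n ^ 'n"
  assumes sym: "transpose A = A"
  obtains U d where "orthogonal_matrix U" "A = U ** diag_mat d ** transpose U"
proof -
  obtain E where E: "pairwise orthogonal E" "span E = (UNIV :: (real ^ 'n) set)"
      "\<forall>e\<in>E. norm e = 1 \<and> (\<exists>l. A *v e = l *\<^sub>R e)"
    using symmetric_has_orthonormal_eigenbasis[OF sym subspace_UNIV] by blast
  have "0 \<notin> E" using E(3) by force
  then have indep: "independent E"
    using E(1) pairwise_orthogonal_independent by blast
  have "card E = CARD('n)"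
    using dim_eq_card[of E UNIV] indep E(2) by simp
  moreover have "finite E"
    using indep independent_imp_finite by blast
  ultimately obtain f where f: "bij_betw f (UNIV :: 'n set) E"
    using finite_same_card_bij[of "UNIV :: 'n set" E] by auto
  have fE: "f j \<in> E" for j
    using f bij_betwE by blast
  then have "\<forall>j. \<exists>l. A *v f j = l *\<^sub>R f j"
    using E(3) by blast
  then obtain d where d: "\<And>j. A *v f j = d j *\<^sub>R f j"
    by metis
  define U where "U = (\<chi> i j. f j $ i)"
  have col: "column j U = f j" for j
    by (simp add: column_def U_def vec_eq_iff)
  have U: "orthogonal_matrix U"
    unfolding orthogonal_matrix_orthonormal_columns col
  proof (intro conjI allI impI)
    show "norm (f i) = 1" for i
      using E(3) fE by blast
    show "orthogonal (f i) (f j)" if "i \<noteq> j" for i j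
      using E(1) fE that f by (metis UNIV_I bij_betw_imp_inj_on inj_onD pairwiseD)
  qed
  have "A ** U = U ** diag_mat d"
  proof -
    have "(A ** U) $ i $ j = (U ** diag_mat d) $ i $ j" for i j
    proof -
      have "(A ** U) $ i $ j = (A *v f j) $ i"
        by (simp add: matrix_matrix_mult_def matrix_vector_mult_def U_def)
      also have "\<dots> = (U ** diag_mat d) $ i $ j"
        by (simp add: d matrix_matrix_mult_def U_def diag_mat_def if_distrib cong: if_cong)
      finally show ?thesis .
    qed
    then show ?thesis by (simp add: vec_eq_iff)
  qed
  then have "A = U ** diag_mat d ** transpose U"
    using U by (metis matrix_mul_assoc matrix_mul_rid orthogonal_matrix_def)
  with U show ?thesis using that by blast
qed

lemma sym_pos_def_diagonalization:
  fixes A :: "real ^ 'n ^ 'n"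
  assumes "sym_pos_def A"
  obtains U d where "orthogonal_matrix U" "\<And>i. 0 < d i" "A = U ** diag_mat d ** transpose U"
proof -
  obtain U d where U: "orthogonal_matrix U" and A: "A = U ** diag_mat d ** transpose U"
    using assms symmetric_orthogonal_diagonalization unfolding sym_pos_def_def by metis
  have "0 < d i" for i
  proof -
    define x where "x = U *v axis i 1"
    have x: "transpose U *v x = axis i 1"
      using U by (simp add: x_def matrix_vector_mul_assoc orthogonal_matrix_def del: transpose_matrix_vector)
    then have "x \<noteq> 0" by (metis axis_eq_0_iff matrix_vector_mult_0_right zero_neq_one)
    then have "0 < x \<bullet> (A *v x)" using assms by (rule sym_pos_def_pos[rotated])
    also have "x \<bullet> (A *v x) = (transpose U *v x) \<bullet> (diag_mat d *v (transpose U *v x))"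
      by (simp add: A matrix_vector_mul_assoc[symmetric] dot_lmul_matrix[symmetric]
          transpose_matrix_vector[symmetric] del: transpose_matrix_vector)
    also have "\<dots> = d i"
      unfolding x inner_axis' by (simp add: diag_mat_vector)
    finally show ?thesis .
  qed
  with U A show ?thesis using that by blast
qed

lemma sym_pos_def_conj_diag:
  assumes U: "orthogonal_matrix U" and d: "\<And>i. 0 < d i"
  shows "sym_pos_def (U ** diag_mat d ** transpose U)"
  unfolding sym_pos_def_def
proof (intro conjI allI impI)
  show "transpose (U ** diag_mat d ** transpose U) = U ** diag_mat d ** transpose U"
    by (simp add: matrix_transpose_mul transpose_diag_mat matrix_mul_assoc)
  fix x :: "real ^ 'a" assume "x \<noteq> 0"
  define y where "y = transpose U *v x"
  have "U *v y = x"
    using U by (simp add: y_def matrix_vector_mul_assoc orthogonal_matrix_def del: transpose_matrix_vector)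
  with \<open>x \<noteq> 0\<close> have "y \<noteq> 0" by auto
  then obtain i where "y $ i \<noteq> 0" by (auto simp: vec_eq_iff)
  have "x \<bullet> ((U ** diag_mat d ** transpose U) *v x) = y \<bullet> (diag_mat d *v y)"
    by (simp add: y_def matrix_vector_mul_assoc[symmetric] dot_lmul_matrix[symmetric]
          transpose_matrix_vector[symmetric] del: transpose_matrix_vector)
  also have "\<dots> = (\<Sum>i\<in>UNIV. d i * (y $ i)\<^sup>2)"
    by (simp add: inner_vec_def diag_mat_vector power2_eq_square mult_ac)
  also have "\<dots> > 0"
    using d \<open>y $ i \<noteq> 0\<close> by (intro sum_pos2[of _ i]) (auto simp: less_imp_le)
  finally show "0 < x \<bullet> ((U ** diag_mat d ** transpose U) *v x)" .
qed

lemma conj_diag_mult: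
  assumes "orthogonal_matrix U"
  shows "(U ** diag_mat d ** transpose U) ** (U ** diag_mat e ** transpose U) =
    U ** diag_mat (\<lambda>i. d i * e i) ** transpose U"
proof -
  have "(U ** diag_mat d ** transpose U) ** (U ** diag_mat e ** transpose U) =
    U ** diag_mat d ** (transpose U ** U) ** diag_mat e ** transpose U"
    by (simp add: matrix_mul_assoc)
  then show ?thesis
    using assms by (simp add: orthogonal_matrix_def diag_mat_mult matrix_mul_assoc[symmetric]) 
      (simp add: matrix_mul_assoc diag_mat_mult)
qed

lemma sym_pos_def_square_root:
  fixes A :: "real ^ 'n ^ 'n"
  assumes "sym_pos_def A"
  obtains S R where "sym_pos_def S" "S ** S = A" "sym_pos_def R" "S ** R = mat 1" "R ** S = mat 1"
    "R ** R = matrix_inv A"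
proof -
  obtain U d where U: "orthogonal_matrix U" and d: "\<And>i. 0 < d i"
    and A: "A = U ** diag_mat d ** transpose U"
    using sym_pos_def_diagonalization[OF assms] by blast
  let ?S = "U ** diag_mat (\<lambda>i. sqrt (d i)) ** transpose U"
  let ?R = "U ** diag_mat (\<lambda>i. 1 / sqrt (d i)) ** transpose U"
  have one: "U ** diag_mat (\<lambda>i. 1) ** transpose U = mat 1"
    using U by (simp add: diag_mat_one orthogonal_matrix_def)
  have d0: "d i \<noteq> 0" for i using d[of i] by simp
  have SR: "?S ** ?R = mat 1"
    unfolding conj_diag_mult[OF U] using one by (simp add: d0)
  have SS: "?S ** ?S = A"
    unfolding conj_diag_mult[OF U] A using d by (simp add: less_imp_le)
  show ?thesis
  proof (rule that[OF _ SS _ SR])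
    show "sym_pos_def ?S" "sym_pos_def ?R"
      by (intro sym_pos_def_conj_diag U; simp add: d)+
    show "?R ** ?S = mat 1"
      using SR matrix_left_right_inverse by blast
    have "A ** (?R ** ?R) = ?S ** (?S ** ?R) ** ?R"
      by (simp only: SS[symmetric] matrix_mul_assoc)
    also have "\<dots> = mat 1"
      by (simp only: SR matrix_mul_rid)
    finally show "?R ** ?R = matrix_inv A"
      by (rule matrix_inv_eqI[symmetric])
  qed
qed

lemma sym_pos_def_matrix_inv:
  fixes A :: "real ^ 'n ^ 'n"
  assumes "sym_pos_def A"
  shows "sym_pos_def (matrix_inv A)" "A ** matrix_inv A = mat 1" "matrix_inv A ** A = mat 1"
proof -
  obtain S R where SR: "sym_pos_def S" "S ** S = A" "sym_pos_def R" "S ** R = mat 1" "R ** S = mat 1"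
    "R ** R = matrix_inv A"
    using sym_pos_def_square_root[OF assms] by blast
  have "A ** matrix_inv A = S ** (S ** R) ** R"
    by (simp only: SR(2) SR(6)[symmetric] matrix_mul_assoc)
  then show "A ** matrix_inv A = mat 1"
    by (simp add: SR(4))
  then show "matrix_inv A ** A = mat 1"
    using matrix_left_right_inverse by blast
  show "sym_pos_def (matrix_inv A)"
    unfolding sym_pos_def_def
  proof (intro conjI allI impI)
    show "transpose (matrix_inv A) = matrix_inv A"
      unfolding SR(6)[symmetric] using SR(3) by (simp add: matrix_transpose_mul sym_pos_def_def)
    fix x :: "real ^ 'n" assume "x \<noteq> 0"
    then have "R *v x \<noteq> 0"
      using SR(4) by (metis matrix_vector_mul_assoc matrix_vector_mul_lid matrix_vector_mult_0_right)
    moreover have "x \<bullet> (matrix_inv A *v x) = (R *v x) \<bullet> (R *v x)"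
      by (simp add: SR(6)[symmetric] matrix_vector_mul_assoc[symmetric] sym_pos_def_inner[OF SR(3)])
    ultimately show "0 < x \<bullet> (matrix_inv A *v x)" by simp
  qed
qed

text \<open>For \<open>D = B - C\<close> one has \<open>B D + D C = B B - C C = 0\<close>. Evaluated at an eigenvector \<open>e\<close> of \<open>D\<close> this says
  that the eigenvalue times \<open>e \<bullet> B e + e \<bullet> C e > 0\<close> vanishes; hence all eigenvalues of \<open>D\<close> are \<open>0\<close>.\<close>

lemma sym_pos_def_square_root_unique:
  fixes B C :: "real ^ 'n ^ 'n"
  assumes B: "sym_pos_def B" and C: "sym_pos_def C" and eq: "B ** B = C ** C"
  shows "B = C"
proof -
  define D where "D = B - C"
  have sym: "transpose D = D"
  proof -
    have "transpose (B - C) = transpose B - transpose C"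
      by (simp add: transpose_def vec_eq_iff)
    then show ?thesis
      using B C by (simp add: D_def sym_pos_def_def)
  qed
  obtain E where E: "pairwise orthogonal E" "span E = (UNIV :: (real ^ 'n) set)"
      "\<forall>e\<in>E. norm e = 1 \<and> (\<exists>l. D *v e = l *\<^sub>R e)"
    using symmetric_has_orthonormal_eigenbasis[OF sym subspace_UNIV] by auto
  have zero: "D *v e = 0" if eE: "e \<in> E" for e
  proof -
    obtain l where e: "norm e = 1" "D *v e = l *\<^sub>R e" using bspec[OF E(3) eE] by auto
    have "B *v (D *v e) + D *v (C *v e) = (B ** B) *v e - (C ** C) *v e"
      by (simp add: D_def matrix_vector_mult_diff_rdistrib matrix_vector_mult_diff_distrib
          matrix_vector_mul_assoc[symmetric])
    then have "e \<bullet> (B *v (D *v e)) + e \<bullet> (D *v (C *v e)) = 0"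
      by (simp add: eq inner_add_right[symmetric])
    then have "l * (e \<bullet> (B *v e) + e \<bullet> (C *v e)) = 0"
      using inner_symmetric_matrix[OF sym, of e "C *v e"]
      by (simp add: e(2) matrix_vector_mult_scaleR distrib_left)
    moreover have "0 < e \<bullet> (B *v e) + e \<bullet> (C *v e)"
      using e(1) by (intro add_pos_pos sym_pos_def_pos B C) auto
    ultimately show ?thesis using e(2) by simp
  qed
  have "D *v x = 0 *v x" for x
    by (rule linear_eq_on[of "(*v) D" "(*v) 0" x E]) (use zero E(2) in auto)
  then have "D = 0" unfolding matrix_eq by blast
  then show ?thesis by (simp add: D_def)
qed

lemma mat_inv_sqrt_eqI:
  fixes A B :: "real ^ 'n ^ 'n"
  assumes "sym_pos_def B" "B ** B = matrix_inv A"
  shows "mat_inv_sqrt A = B"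
  unfolding mat_inv_sqrt_def
proof (rule the_equality)
  show "sym_pos_def B \<and> B ** B = matrix_inv A" using assms by simp
  show "C = B" if "sym_pos_def C \<and> C ** C = matrix_inv A" for C
    using sym_pos_def_square_root_unique[of C B] that assms by simp
qed

section \<open>The Kronecker structure\<close>

lemma sum_prod_UNIV:
  "(\<Sum>k\<in>UNIV. f k) = (\<Sum>i\<in>UNIV. \<Sum>j\<in>UNIV. f (i, j))"
  by (simp add: sum.cartesian_product UNIV_Times_UNIV)

lemma kron_mult: "kron A B ** kron A' B' = kron (A ** A') (B ** B')"
  by (simp add: kron_def matrix_matrix_mult_def vec_eq_iff sum_prod_UNIV sum_product mult_ac)

lemma kron_one: "kron (mat 1) (mat 1) = mat 1"
  by (auto simp: kron_def mat_def vec_eq_iff prod_eq_iff)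

lemma matrix_inv_kron:
  assumes "sym_pos_def \<Omega>" "sym_pos_def \<Phi>"
  shows "matrix_inv (kron \<Omega> \<Phi>) = kron (matrix_inv \<Omega>) (matrix_inv \<Phi>)"
  by (rule matrix_inv_eqI) (simp add: kron_mult kron_one assms sym_pos_def_matrix_inv)

lemma kron_mult_kron_col: "kron A B ** kron_col v M = kron_col (A *v v) (B ** M)"
  by (simp add: kron_def kron_col_def matrix_matrix_mult_def matrix_vector_mult_def
      vec_eq_iff sum_prod_UNIV sum_product mult_ac)

lemma transpose_kron_col_mult: "transpose (kron_col u (mat 1)) ** kron_col v M = (u \<bullet> v) *\<^sub>R M"
proof -
  have "(\<Sum>p\<in>UNIV. u $ i * (mat 1 :: real ^ 'b ^ 'b) $ p $ q * (v $ i * M $ p $ r)) = u $ i * v $ i * M $ q $ r"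
    for i q r
    by (simp add: mat_def if_distrib[of "\<lambda>x. x * _"] if_distrib[of "\<lambda>x. _ * x"] cong: if_cong)
  then show ?thesis
    by (simp add: kron_col_def matrix_matrix_mult_def transpose_def vec_eq_iff sum_prod_UNIV
        inner_vec_def sum_distrib_right)
qed

text \<open>Contracting the first factor of a Kronecker product from both sides leaves a multiple of
  the other factor. This is what makes both of the matrices under the inverse square roots
  proportional to \<open>\<Phi>\<close> and to its inverse.\<close>

lemma kron_col_sandwich:
  "transpose (kron_col u (mat 1)) ** kron A B ** kron_col v (mat 1) = (u \<bullet> (A *v v)) *\<^sub>R B"
  unfolding matrix_mul_assoc[symmetric] by (simp add: kron_mult_kron_col transpose_kron_col_mult)

lemma b_vec_nonzero: "b_vec \<beta> \<noteq> 0" and a_vec_nonzero: "a_vec \<beta> \<noteq> 0"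
  by (auto simp: a_vec_def b_vec_def vec_eq_iff forall_2)

lemma powr_minus_half_square:
  fixes x :: real
  assumes "0 < x"
  shows "x powr (- 1 / 2) * x powr (- 1 / 2) = inverse x"
  using assms powr_add[of x "- 1 / 2" "- 1 / 2"] by (simp add: powr_minus)

lemma scaled_root_mult:
  fixes M :: "real ^ 'n ^ 'n"
  assumes "0 < (x :: real)"
  shows "(x powr (- 1 / 2) *\<^sub>R M) ** (x powr (- 1 / 2) *\<^sub>R M) = inverse x *\<^sub>R (M ** M)"
  unfolding powr_minus_half_square[OF assms, symmetric]
  by (simp add: matrix_scalar_ac scalar_matrix_assoc[symmetric])

text \<open>With \<open>R = \<Phi>\<^sup>-\<^sup>1\<^sup>/\<^sup>2\<close> and \<open>S = R\<^sup>-\<^sup>1\<close>, the sandwich formula gives \<open>C = (b\<^sub>0 \<bullet> \<Omega> b\<^sub>0)\<^sup>-\<^sup>1\<^sup>/\<^sup>2 R\<close> and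
  \<open>D = d\<^sub>\<beta> S \<Phi>\<^sup>-\<^sup>1 = d\<^sub>\<beta> R\<close>, so that both means are scalar multiples of the same vector \<open>R \<mu>\<close>.\<close>

lemma joint_density_kron:
  fixes \<Phi> S R :: "real ^ 'k ^ 'k"
  assumes \<Omega>: "sym_pos_def \<Omega>" and \<Phi>: "sym_pos_def \<Phi>"
    and S: "sym_pos_def S" "S ** S = \<Phi>" and R: "sym_pos_def R" "S ** R = mat 1" "R ** S = mat 1"
    "R ** R = matrix_inv \<Phi>"
  shows "joint_density \<beta>0 (kron \<Omega> \<Phi>) \<beta> \<mu> s t =
    mvn_density (c_coef \<beta>0 \<Omega> \<beta> *\<^sub>R (R *v \<mu>)) (mat 1) s *
    mvn_density (d_coef \<beta>0 \<Omega> \<beta> *\<^sub>R (R *v \<mu>)) (mat 1) t"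
proof -
  define \<omega> where "\<omega> = b_vec \<beta>0 \<bullet> (\<Omega> *v b_vec \<beta>0)"
  define u where "u = a_vec \<beta>0 \<bullet> (matrix_inv \<Omega> *v a_vec \<beta>0)"
  have pos: "0 < \<omega>" "0 < u"
    unfolding \<omega>_def u_def
    using sym_pos_def_pos[OF \<Omega> b_vec_nonzero] sym_pos_def_pos[OF sym_pos_def_matrix_inv(1)[OF \<Omega>] a_vec_nonzero]
    by auto
  note I = sym_pos_def_matrix_inv[OF \<Phi>]
  have C: "C_mat \<beta>0 (kron \<Omega> \<Phi>) = \<omega> powr (- 1 / 2) *\<^sub>R R"
    unfolding C_mat_def kron_col_sandwich \<omega>_def[symmetric]
  proof (rule mat_inv_sqrt_eqI)
    show "sym_pos_def (\<omega> powr (- 1 / 2) *\<^sub>R R)"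
      using pos R by (simp add: sym_pos_def_scaleR)
    have "matrix_inv (\<omega> *\<^sub>R \<Phi>) = inverse \<omega> *\<^sub>R matrix_inv \<Phi>"
      using pos I by (intro matrix_inv_eqI) (simp add: matrix_scalar_ac scalar_matrix_assoc[symmetric])
    then show "\<omega> powr (- 1 / 2) *\<^sub>R R ** \<omega> powr (- 1 / 2) *\<^sub>R R = matrix_inv (\<omega> *\<^sub>R \<Phi>)"
      unfolding scaled_root_mult[OF pos(1)] by (simp add: R)
  qed
  have "mat_inv_sqrt (u *\<^sub>R matrix_inv \<Phi>) = u powr (- 1 / 2) *\<^sub>R S"
  proof (rule mat_inv_sqrt_eqI)
    show "sym_pos_def (u powr (- 1 / 2) *\<^sub>R S)"
      using pos S by (simp add: sym_pos_def_scaleR)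
    have "matrix_inv (u *\<^sub>R matrix_inv \<Phi>) = inverse u *\<^sub>R \<Phi>"
      using pos I by (intro matrix_inv_eqI) (simp add: matrix_scalar_ac scalar_matrix_assoc[symmetric])
    then show "u powr (- 1 / 2) *\<^sub>R S ** u powr (- 1 / 2) *\<^sub>R S = matrix_inv (u *\<^sub>R matrix_inv \<Phi>)"
      unfolding scaled_root_mult[OF pos(2)] by (simp add: S)
  qed
  moreover have "S ** matrix_inv \<Phi> = R"
    by (metis R(2,4) matrix_mul_assoc matrix_mul_lid)
  moreover have "a_vec \<beta>0 \<bullet> (matrix_inv \<Omega> *v a_vec \<beta>) = a_vec \<beta> \<bullet> (matrix_inv \<Omega> *v a_vec \<beta>0)"
    by (metis sym_pos_def_inner[OF sym_pos_def_matrix_inv(1)[OF \<Omega>]] inner_commute)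
  ultimately have D: "D_mat \<beta>0 (kron \<Omega> \<Phi>) \<beta> = d_coef \<beta>0 \<Omega> \<beta> *\<^sub>R R"
    unfolding D_mat_def matrix_inv_kron[OF \<Omega> \<Phi>] kron_col_sandwich d_coef_def u_def[symmetric]
    by (simp add: matrix_scalar_ac scalar_matrix_assoc[symmetric])
  show ?thesis
    unfolding joint_density_def C D c_coef_def \<omega>_def[symmetric]
    by (simp add: scaleR_matrix_vector_assoc[symmetric])
qed

section \<open>Linear changes of variables for Lebesgue measure\<close>

text \<open>Uniqueness of Haar measure on a Euclidean space. Substituting \<open>y \<mapsto> y - x\<close> under Lebesgue measure,
  exchanging the integrals, and then substituting \<open>x \<mapsto> x + y\<close> under \<open>M\<close> turns
  \<open>M(A) \<cdot> lborel(B)\<close> into \<open>lborel(A) \<cdot> M(-B)\<close>. The ball \<open>B\<close> is symmetric, and the hypothesis on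
  balls provides both the sigma-finiteness of \<open>M\<close> and the normalization \<open>M(B) = lborel(B)\<close>.\<close>

lemma translation_invariant_eq_lborel:
  fixes M :: "'a::euclidean_space measure"
  assumes sets_M[measurable_cong]: "sets M = sets borel"
    and trans: "\<And>a. distr M borel ((+) a) = M"
    and balls: "\<And>r. emeasure M (ball 0 r) = emeasure lborel (ball (0::'a) r)"
  shows "M = lborel"
proof (rule measure_eqI)
  interpret M: sigma_finite_measure M
  proof
    show "\<exists>A. countable A \<and> A \<subseteq> sets M \<and> \<Union>A = space M \<and> (\<forall>a\<in>A. emeasure M a \<noteq> \<infinity>)"
    proof (intro exI[of _ "range (\<lambda>n::nat. ball 0 (real n))"] conjI)
      show "\<Union>(range (\<lambda>n::nat. ball 0 (real n))) = space M"
        using sets_eq_imp_space_eq[OF sets_M] by (auto simp: reals_Archimedean2)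
      show "\<forall>a\<in>range (\<lambda>n::nat. ball 0 (real n)). emeasure M a \<noteq> \<infinity>"
        using emeasure_bounded_finite[OF bounded_ball] by (auto simp: balls less_top)
    qed (auto simp: sets_M)
  qed
  interpret pair_sigma_finite M "lborel :: 'a measure" ..
  show "sets M = sets lborel" by (simp add: sets_M)
  fix A assume "A \<in> sets M"
  then have A[measurable]: "A \<in> sets borel" by (simp add: sets_M)
  let ?B = "ball (0::'a) 1"
  have B[measurable]: "?B \<in> sets borel" by simp
  have shift: "(\<integral>\<^sup>+x. f x \<partial>N) = (\<integral>\<^sup>+x. f (a + x) \<partial>N)"
    if N: "N = M \<or> N = lborel" and f: "f \<in> borel_measurable borel" for f :: "'a \<Rightarrow> ennreal" and a N
  proof -
    have [measurable_cong]: "sets N = sets borel"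
      using N by (rule disjE) (simp_all only: sets_M sets_lborel)
    have "distr N borel ((+) a) = N"
      using N by (rule disjE) (simp_all only: trans lborel_distr_plus)
    then have "(\<integral>\<^sup>+x. f x \<partial>N) = (\<integral>\<^sup>+x. f x \<partial>distr N borel ((+) a))"
      by simp
    also have "\<dots> = (\<integral>\<^sup>+x. f (a + x) \<partial>N)"
      using f by (subst nn_integral_distr) auto
    finally show ?thesis .
  qed
  have "emeasure M A * emeasure lborel ?B
      = (\<integral>\<^sup>+x. \<integral>\<^sup>+y. indicator A x * indicator ?B y \<partial>lborel \<partial>M)"
    using A by (simp add: nn_integral_cmult_indicator nn_integral_multc sets_M)
  also have "\<dots> = (\<integral>\<^sup>+x. \<integral>\<^sup>+y. indicator A x * indicator ?B (- x + y) \<partial>lborel \<partial>M)"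
    by (rule nn_integral_cong, rule shift) auto
  also have "\<dots> = (\<integral>\<^sup>+y. \<integral>\<^sup>+x. indicator A x * indicator ?B (- x + y) \<partial>M \<partial>lborel)"
    by (rule Fubini'[symmetric]) measurable
  also have "\<dots> = (\<integral>\<^sup>+y. \<integral>\<^sup>+x. indicator A (y + x) * indicator ?B (- (y + x) + y) \<partial>M \<partial>lborel)"
    by (rule nn_integral_cong, rule shift) auto
  also have "\<dots> = (\<integral>\<^sup>+y. \<integral>\<^sup>+x. indicator A (x + y) * indicator ?B x \<partial>M \<partial>lborel)"
    by (intro nn_integral_cong) (auto simp: indicator_def add.commute)
  also have "\<dots> = (\<integral>\<^sup>+x. \<integral>\<^sup>+y. indicator A (x + y) * indicator ?B x \<partial>lborel \<partial>M)"
    by (rule Fubini') measurable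
  also have "\<dots> = (\<integral>\<^sup>+x. \<integral>\<^sup>+y. indicator A y * indicator ?B x \<partial>lborel \<partial>M)"
    by (rule nn_integral_cong, rule shift[symmetric]) auto
  also have "\<dots> = emeasure lborel A * emeasure lborel ?B"
    using A by (simp add: nn_integral_cmult_indicator nn_integral_multc balls sets_M)
  finally have eq: "emeasure M A * emeasure lborel ?B = emeasure lborel A * emeasure lborel ?B" .
  have "emeasure lborel ?B \<noteq> 0"
    using content_ball_pos[of 1 "0::'a"] by (auto simp: measure_def)
  moreover have "emeasure lborel ?B \<noteq> \<top>"
    using emeasure_bounded_finite[OF bounded_ball, of "0::'a" 1] by simp
  ultimately show "emeasure M A = emeasure lborel A"
    using eq by (simp add: ennreal_mult_cancel_left mult.commute[of _ "emeasure lborel ?B"])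
qed

text \<open>The image of Lebesgue measure under a linear bijection is translation invariant, and an orthogonal
  map preserves the balls around the origin.\<close>

lemma lborel_distr_orthogonal_transformation:
  fixes f :: "'a::euclidean_space \<Rightarrow> 'a"
  assumes f: "orthogonal_transformation f"
  shows "distr lborel borel f = lborel"
proof (rule translation_invariant_eq_lborel)
  have lin: "linear f" by (rule orthogonal_transformation_linear[OF f])
  have [measurable]: "f \<in> borel_measurable borel"
    by (intro borel_measurable_continuous_onI linear_continuous_on linear_conv_bounded_linear[THEN iffD1] lin)
  show "distr (distr lborel borel f) borel ((+) a) = distr lborel borel f" for a
  proof -
    obtain b where b: "f b = a"
      using orthogonal_transformation_surj[OF f] by (metis surjD)
    have "distr (distr lborel borel f) borel ((+) a) = distr lborel borel (\<lambda>x. f (b + x))"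
      by (subst distr_distr) (auto simp: comp_def linear_add[OF lin] b)
    also have "\<dots> = distr (distr lborel borel ((+) b)) borel f"
      by (subst distr_distr) (auto simp: comp_def)
    finally show ?thesis by (simp add: lborel_distr_plus)
  qed
  have "f -` ball 0 r = ball 0 r" for r
    using orthogonal_transformation_norm[OF f] by auto
  then show "emeasure (distr lborel borel f) (ball 0 r) = emeasure lborel (ball (0::'a) r)" for r
    by (simp add: emeasure_distr)
qed simp

lemma borel_measurable_matrix_vector[measurable]: "(*v) (A :: real ^ 'n ^ 'm) \<in> borel_measurable borel"
  by (intro borel_measurable_continuous_onI continuous_intros)

lemma nn_integral_orthogonal_matrix:
  fixes U :: "real ^ 'n ^ 'n"
  assumes U: "orthogonal_matrix U" and [measurable]: "f \<in> borel_measurable borel"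
  shows "(\<integral>\<^sup>+x. f (U *v x) \<partial>lborel) = (\<integral>\<^sup>+x. f x \<partial>lborel)"
proof -
  have "orthogonal_transformation ((*v) U)"
    using U by (simp add: orthogonal_transformation_matrix)
  from lborel_distr_orthogonal_transformation[OF this] show ?thesis
    using nn_integral_distr[of "(*v) U" lborel borel f] by simp
qed

lemma nn_integral_diag_mat:
  fixes d :: "'n::finite \<Rightarrow> real"
  assumes d: "\<And>i. d i \<noteq> 0" and [measurable]: "f \<in> borel_measurable borel"
  shows "(\<integral>\<^sup>+x. f x \<partial>lborel) = ennreal \<bar>det (diag_mat d)\<bar> * (\<integral>\<^sup>+x. f (diag_mat d *v x) \<partial>lborel)"
proof -
  define c where "c b = (diag_mat d *v b) \<bullet> b" for b :: "real ^ 'n"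
  have Basis: "(Basis :: (real ^ 'n) set) = range (\<lambda>i. axis i 1)"
    by (auto simp: Basis_vec_def)
  have c: "c (axis i 1) = d i" for i
    by (simp add: c_def inner_axis diag_mat_vector)
  have T: "0 + (\<Sum>j\<in>Basis. (c j * (x \<bullet> j)) *\<^sub>R j) = diag_mat d *v x" for x
  proof (rule euclidean_eqI)
    fix b :: "real ^ 'n" assume b: "b \<in> Basis"
    then obtain i where i: "b = axis i 1" by (auto simp: Basis)
    show "(0 + (\<Sum>j\<in>Basis. (c j * (x \<bullet> j)) *\<^sub>R j)) \<bullet> b = (diag_mat d *v x) \<bullet> b"
      using b by (simp add: inner_sum_left_Basis) (simp add: i c inner_axis diag_mat_vector)
  qed
  have "c j \<noteq> 0" if "j \<in> Basis" for j
    using that d by (auto simp: Basis c)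
  from lborel_affine_euclidean[of c 0, OF this]
  have eq: "lborel = density (distr lborel borel ((*v) (diag_mat d))) (\<lambda>_. ennreal (\<Prod>j\<in>Basis. \<bar>c j\<bar>))"
    unfolding T by simp
  have "(\<Prod>j\<in>Basis. \<bar>c j\<bar>) = \<bar>det (diag_mat d)\<bar>"
    unfolding Basis by (subst prod.reindex) (auto simp: inj_on_def axis_eq_axis c det_diag_mat abs_prod)
  then show ?thesis
    by (subst eq) (simp add: nn_integral_density nn_integral_distr nn_integral_cmult)
qed

text \<open>Diagonalization splits the substitution into two orthogonal ones, which preserve the integral, and
  a diagonal one, which only rescales the coordinates.\<close>

lemma nn_integral_sym_pos_def_substitution:
  fixes B :: "real ^ 'n ^ 'n"
  assumes B: "sym_pos_def B" and [measurable]: "f \<in> borel_measurable borel"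
  shows "(\<integral>\<^sup>+x. f x \<partial>lborel) = ennreal \<bar>det B\<bar> * (\<integral>\<^sup>+x. f (B *v x) \<partial>lborel)"
proof -
  obtain U d where U: "orthogonal_matrix U" and d: "\<And>i. 0 < d i"
    and Beq: "B = U ** diag_mat d ** transpose U"
    using sym_pos_def_diagonalization[OF B] by blast
  have d0: "d i \<noteq> 0" for i using d[of i] by simp
  have "det B = det U * det U * det (diag_mat d)"
    by (simp add: Beq det_mul)
  moreover have "det U * det U = 1"
    using det_orthogonal_matrix[OF U] by auto
  ultimately have det: "det B = det (diag_mat d)" by simp
  have "(\<integral>\<^sup>+x. f x \<partial>lborel) = (\<integral>\<^sup>+x. f (U *v x) \<partial>lborel)"
    by (rule nn_integral_orthogonal_matrix[OF U, symmetric]) simp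
  also have "\<dots> = ennreal \<bar>det B\<bar> * (\<integral>\<^sup>+x. f (U *v (diag_mat d *v x)) \<partial>lborel)"
    unfolding det by (rule nn_integral_diag_mat[OF d0]) measurable
  also have "(\<integral>\<^sup>+x. f (U *v (diag_mat d *v x)) \<partial>lborel) =
      (\<integral>\<^sup>+x. f (U *v (diag_mat d *v (transpose U *v x))) \<partial>lborel)"
    by (rule nn_integral_orthogonal_matrix[symmetric]) (use U in auto)
  also have "\<dots> = (\<integral>\<^sup>+x. f (B *v x) \<partial>lborel)"
    by (simp add: Beq matrix_vector_mul_assoc matrix_mul_assoc del: transpose_matrix_vector)
  finally show ?thesis .
qed

section \<open>The normal distribution\<close>

definition std_mvn :: "(real ^ 'n) measure" where
  "std_mvn = mvn 0 (mat 1)"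

lemma matrix_inv_mat_1: "matrix_inv (mat 1 :: real ^ 'n ^ 'n) = mat 1"
  by (rule matrix_inv_eqI) simp

lemma mvn_density_mat_1:
  "mvn_density m (mat 1) (x :: real ^ 'n) = exp (- ((x - m) \<bullet> (x - m)) / 2) / sqrt ((2 * pi) ^ CARD('n))"
  by (simp add: mvn_density_def matrix_inv_mat_1)

lemma measurable_mvn_density[measurable]: "mvn_density m V \<in> borel_measurable borel"
  unfolding mvn_density_def by measurable

lemma sets_std_mvn[simp, measurable_cong]: "sets std_mvn = sets borel"
  and space_std_mvn[simp]: "space std_mvn = UNIV"
  by (simp_all add: std_mvn_def mvn_def)

text \<open>The density is the product of the standard normal densities of the coordinates.\<close>

lemma prob_space_std_mvn: "prob_space (std_mvn :: (real ^ 'n) measure)"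
proof
  have Basis: "(Basis :: (real ^ 'n) set) = range (\<lambda>i. axis i 1)"
    by (auto simp: Basis_vec_def)
  have prod: "mvn_density 0 (mat 1) x = (\<Prod>b\<in>Basis. std_normal_density (x \<bullet> b))" for x :: "real ^ 'n"
  proof -
    have "(\<Prod>b\<in>Basis. std_normal_density (x \<bullet> b)) =
      (1 / sqrt (2 * pi)) ^ CARD('n) * exp (\<Sum>b\<in>Basis. - (x \<bullet> b)\<^sup>2 / 2)"
      by (simp add: std_normal_density_def prod.distrib exp_sum prod_dividef power_one_over)
    also have "(\<Sum>b\<in>Basis. - (x \<bullet> b)\<^sup>2 / 2) = - (x \<bullet> x) / 2"
      by (subst euclidean_inner[of x x])
        (simp add: power2_eq_square sum_negf sum_divide_distrib)
    finally show ?thesis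
      unfolding mvn_density_mat_1 real_sqrt_power by (simp add: power_one_over)
  qed
  have "emeasure (std_mvn :: (real ^ 'n) measure) (space std_mvn) =
      (\<integral>\<^sup>+(x :: real ^ 'n). (\<Prod>b\<in>Basis. ennreal (std_normal_density (x \<bullet> b))) \<partial>lborel)"
    by (simp add: std_mvn_def mvn_def emeasure_density prod prod_ennreal)
  also have "\<dots> = (\<Prod>b\<in>(Basis :: (real ^ 'n) set). \<integral>\<^sup>+x. ennreal (std_normal_density x) \<partial>lborel)"
    by (rule nn_integral_lborel_prod) auto
  also have "(\<integral>\<^sup>+x. ennreal (std_normal_density x) \<partial>lborel) = 1"
    by (subst nn_integral_eq_integral) auto
  finally show "emeasure (std_mvn :: (real ^ 'n) measure) (space std_mvn) = 1" by simp
qed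

text \<open>The usual representation of a centred normal vector as a linear image of a standard one. It also
  shows that the normal laws used below are probability measures depending measurably on their
  scale.\<close>

lemma mvn_eq_distr_std_mvn:
  fixes B :: "real ^ 'n ^ 'n"
  assumes B: "sym_pos_def B"
  shows "mvn 0 (B ** B) = distr std_mvn borel ((*v) B)"
proof (rule measure_eqI)
  show "sets (mvn 0 (B ** B)) = sets (distr std_mvn borel ((*v) B))"
    by (simp add: mvn_def)
  fix X assume "X \<in> sets (mvn 0 (B ** B))"
  then have X[measurable]: "X \<in> sets borel" by (simp add: mvn_def)
  note I = sym_pos_def_matrix_inv[OF B]
  have "(B ** B) ** (matrix_inv B ** matrix_inv B) = B ** (B ** matrix_inv B) ** matrix_inv B"
    by (simp only: matrix_mul_assoc)
  then have inv: "matrix_inv (B ** B) = matrix_inv B ** matrix_inv B"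
    by (intro matrix_inv_eqI) (simp add: I)
  have cancel: "matrix_inv B *v (B *v x) = x" "B *v (matrix_inv B *v x) = x" for x
    by (simp_all add: matrix_vector_mul_assoc I)
  have quad: "(B *v x) \<bullet> (matrix_inv (B ** B) *v (B *v x)) = x \<bullet> x" for x
    by (simp add: inv matrix_vector_mul_assoc[symmetric] sym_pos_def_inner[OF B, symmetric] cancel)
  have "det B * det (matrix_inv B) = 1"
    by (metis I(2) det_I det_mul)
  then have "det B \<noteq> 0" by auto
  then have dens: "\<bar>det B\<bar> * mvn_density 0 (B ** B) (B *v x) = mvn_density 0 (mat 1) x" for x
    by (simp add: mvn_density_mat_1) (simp add: mvn_density_def quad det_mul real_sqrt_mult)
  have "emeasure (mvn 0 (B ** B)) X = (\<integral>\<^sup>+x. ennreal (mvn_density 0 (B ** B) x) * indicator X x \<partial>lborel)"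
    by (simp add: mvn_def emeasure_density)
  also have "\<dots> = ennreal \<bar>det B\<bar> * (\<integral>\<^sup>+x. ennreal (mvn_density 0 (B ** B) (B *v x)) * indicator X (B *v x) \<partial>lborel)"
    by (rule nn_integral_sym_pos_def_substitution[OF B]) measurable
  also have "\<dots> = (\<integral>\<^sup>+x. ennreal (mvn_density 0 (mat 1) x) * indicator X (B *v x) \<partial>lborel)"
    by (subst nn_integral_cmult[symmetric])
      (auto simp: dens[symmetric] ennreal_mult' mult.assoc intro!: nn_integral_cong)
  also have "\<dots> = emeasure std_mvn ((*v) B -` X)"
    by (simp add: std_mvn_def mvn_def emeasure_density indicator_def[abs_def] vimage_def)
  also have "\<dots> = emeasure (distr std_mvn borel ((*v) B)) X"
    by (simp add: emeasure_distr)
  finally show "emeasure (mvn 0 (B ** B)) X = emeasure (distr std_mvn borel ((*v) B)) X" .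
qed

lemma std_mvn_distr_orthogonal_transformation:
  fixes f :: "real ^ 'n \<Rightarrow> real ^ 'n"
  assumes f: "orthogonal_transformation f"
  shows "distr std_mvn borel f = std_mvn"
proof (rule measure_eqI)
  have lin: "linear f" by (rule orthogonal_transformation_linear[OF f])
  have [measurable]: "f \<in> borel_measurable borel"
    by (intro borel_measurable_continuous_onI linear_continuous_on linear_conv_bounded_linear[THEN iffD1] lin)
  fix X assume "X \<in> sets (distr std_mvn borel f)"
  then have X[measurable]: "X \<in> sets borel" by simp
  have dens: "mvn_density 0 (mat 1) (f x) = mvn_density 0 (mat 1) x" for x
    using f by (simp add: mvn_density_mat_1 orthogonal_transformation_def)
  have "emeasure (distr std_mvn borel f) X = emeasure std_mvn (f -` X)"
    by (simp add: emeasure_distr)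
  also have "\<dots> = (\<integral>\<^sup>+x. ennreal (mvn_density 0 (mat 1) (f x)) * indicator X (f x) \<partial>lborel)"
    by (simp add: std_mvn_def mvn_def emeasure_density indicator_def[abs_def] vimage_def dens)
  also have "\<dots> = (\<integral>\<^sup>+x. ennreal (mvn_density 0 (mat 1) x) * indicator X x \<partial>distr lborel borel f)"
    by (simp add: nn_integral_distr)
  also have "\<dots> = emeasure std_mvn X"
    by (simp add: std_mvn_def mvn_def emeasure_density lborel_distr_orthogonal_transformation[OF f])
  finally show "emeasure (distr std_mvn borel f) X = emeasure std_mvn X" .
qed simp

interpretation std_mvn: prob_space "std_mvn :: (real ^ 'n) measure"
  by (rule prob_space_std_mvn)

section \<open>The density averaged over a standard normal mean\<close>

text \<open>The density of the pair of \<open>c W + S\<close> and \<open>d W + T\<close> for independent standard normal vectors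
  \<open>W\<close>, \<open>S\<close>, \<open>T\<close>. Both weighted averages are mixtures of it over \<open>(c, d)\<close>.\<close>

definition std_mixture :: "real \<Rightarrow> real \<Rightarrow> real ^ 'n \<Rightarrow> real ^ 'n \<Rightarrow> real" where
  "std_mixture c d s t =
    (\<integral>w. mvn_density (c *\<^sub>R w) (mat 1) s * mvn_density (d *\<^sub>R w) (mat 1) t \<partial>std_mvn)"

text \<open>Some orthogonal map takes \<open>v\<close> to \<open>v'\<close>, and it preserves the standard normal law. Rotating the
  vector that is integrated out takes the place of rotating the pair \<open>(s, t)\<close>.\<close>

lemma exp_integral_std_mvn_cong:
  fixes v v' :: "real ^ 'n"
  assumes "norm v = norm v'"
  shows "(\<integral>w. exp (v \<bullet> w - a * (w \<bullet> w)) \<partial>std_mvn) = (\<integral>w. exp (v' \<bullet> w - a * (w \<bullet> w)) \<partial>std_mvn)"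
proof -
  obtain f where f: "orthogonal_transformation f" "f v = v'"
    using orthogonal_transformation_exists[OF assms] by blast
  have [measurable]: "f \<in> borel_measurable borel"
    by (intro borel_measurable_continuous_onI linear_continuous_on linear_conv_bounded_linear[THEN iffD1]
        orthogonal_transformation_linear f)
  have "(\<integral>w. exp (v' \<bullet> w - a * (w \<bullet> w)) \<partial>std_mvn)
      = (\<integral>w. exp (v' \<bullet> w - a * (w \<bullet> w)) \<partial>distr std_mvn borel f)"
    by (simp add: std_mvn_distr_orthogonal_transformation[OF f(1)])
  also have "\<dots> = (\<integral>w. exp (f v \<bullet> f w - a * (f w \<bullet> f w)) \<partial>std_mvn)"
    by (subst integral_distr) (auto simp: f(2))
  also have "\<dots> = (\<integral>w. exp (v \<bullet> w - a * (w \<bullet> w)) \<partial>std_mvn)"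
    using f(1) by (simp add: orthogonal_transformation_def)
  finally show ?thesis by simp
qed

lemma std_mixture_eq:
  fixes s t :: "real ^ 'n"
  shows "std_mixture c d s t = exp (- (s \<bullet> s + t \<bullet> t) / 2) / (2 * pi) ^ CARD('n) *
    (\<integral>w. exp ((c *\<^sub>R s + d *\<^sub>R t) \<bullet> w - ((c\<^sup>2 + d\<^sup>2) / 2) * (w \<bullet> w)) \<partial>std_mvn)"
proof -
  have "mvn_density (c *\<^sub>R w) (mat 1) s * mvn_density (d *\<^sub>R w) (mat 1) t =
    exp (- (s \<bullet> s + t \<bullet> t) / 2) / (2 * pi) ^ CARD('n) *
      exp ((c *\<^sub>R s + d *\<^sub>R t) \<bullet> w - ((c\<^sup>2 + d\<^sup>2) / 2) * (w \<bullet> w))" for w :: "real ^ 'n"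
  proof -
    have "- ((s - c *\<^sub>R w) \<bullet> (s - c *\<^sub>R w)) / 2 + - ((t - d *\<^sub>R w) \<bullet> (t - d *\<^sub>R w)) / 2 =
      - (s \<bullet> s + t \<bullet> t) / 2 + ((c *\<^sub>R s + d *\<^sub>R t) \<bullet> w - ((c\<^sup>2 + d\<^sup>2) / 2) * (w \<bullet> w))"
      by (simp add: inner_simps inner_commute[of w s] inner_commute[of w t] power2_eq_square field_simps)
    moreover have "sqrt ((2 * pi) ^ CARD('n)) * sqrt ((2 * pi) ^ CARD('n)) = (2 * pi) ^ CARD('n)"
      by simp
    moreover have "exp x / N * (exp y / N) = exp (x + y) / (N * N)" for x y N :: real
      by (simp add: exp_add)
    ultimately have "mvn_density (c *\<^sub>R w) (mat 1) s * mvn_density (d *\<^sub>R w) (mat 1) t =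
      exp (- (s \<bullet> s + t \<bullet> t) / 2 + ((c *\<^sub>R s + d *\<^sub>R t) \<bullet> w - ((c\<^sup>2 + d\<^sup>2) / 2) * (w \<bullet> w)))
        / (2 * pi) ^ CARD('n)"
      by (simp only: mvn_density_mat_1)
    then show ?thesis
      by (simp only: exp_add times_divide_eq_left)
  qed
  then show ?thesis
    unfolding std_mixture_def by simp
qed

text \<open>The vector \<open>c s + d t\<close> in the exponential integral matters only through its norm, whose square is
  \<open>c\<^sup>2 (s \<bullet> s) + d\<^sup>2 (t \<bullet> t) + 2 c d (s \<bullet> t)\<close>. Hence the Gram entries of \<open>(s, t)\<close> suffice, the common sign of
  \<open>(c, d)\<close> is immaterial, and a sign change of \<open>c d\<close> can be traded for one of \<open>s \<bullet> t\<close>.\<close>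

lemma std_mixture_cong:
  fixes s t s' t' :: "real ^ 'n"
  assumes "c'\<^sup>2 = c\<^sup>2" "d'\<^sup>2 = d\<^sup>2" "s' \<bullet> s' = s \<bullet> s" "t' \<bullet> t' = t \<bullet> t"
    and cross: "c' * d' * (s' \<bullet> t') = c * d * (s \<bullet> t)"
  shows "std_mixture c' d' s' t' = std_mixture c d s t"
proof -
  have sq: "(c *\<^sub>R s + d *\<^sub>R t) \<bullet> (c *\<^sub>R s + d *\<^sub>R t) = c\<^sup>2 * (s \<bullet> s) + d\<^sup>2 * (t \<bullet> t) + 2 * (c * d * (s \<bullet> t))"
    for c d and s t :: "real ^ 'n"
    by (simp add: inner_simps inner_commute[of t s] power2_eq_square algebra_simps)
  have "norm (c' *\<^sub>R s' + d' *\<^sub>R t') = norm (c *\<^sub>R s + d *\<^sub>R t)"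
    unfolding norm_eq sq using assms by simp
  from exp_integral_std_mvn_cong[OF this] show ?thesis
    by (simp only: std_mixture_eq assms(1-4))
qed

lemma measurable_mvn_density_mean[measurable (raw)]:
  fixes g :: "'a \<Rightarrow> real ^ 'n"
  assumes [measurable]: "g \<in> borel_measurable M"
  shows "(\<lambda>x. mvn_density (g x) (mat 1) s) \<in> borel_measurable M"
  unfolding mvn_density_mat_1 by measurable

lemma measurable_std_mixture[measurable (raw)]:
  fixes s t :: "real ^ 'n"
  assumes [measurable]: "f \<in> borel_measurable M" "g \<in> borel_measurable M"
  shows "(\<lambda>x. std_mixture (f x) (g x) s t) \<in> borel_measurable M"
  unfolding std_mixture_def by measurable

lemma mvn_density_mat_1_bounds:
  fixes m s :: "real ^ 'n"
  shows "0 \<le> mvn_density m (mat 1) s" "mvn_density m (mat 1) s \<le> 1 / sqrt ((2 * pi) ^ CARD('n))"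
  unfolding mvn_density_mat_1 by (auto intro!: divide_right_mono)

text \<open>Boundedness gives the integrability needed for Fubini and for integrating over the law of
  \<open>(\<beta>, \<mu>)\<close> in two stages.\<close>

lemma mvn_density_product_bound:
  fixes s t :: "real ^ 'n"
  shows "\<bar>mvn_density m (mat 1) s * mvn_density n (mat 1) t\<bar>
    \<le> (1 / sqrt ((2 * pi) ^ CARD('n))) * (1 / sqrt ((2 * pi) ^ CARD('n)))"
  unfolding abs_mult abs_of_nonneg[OF mvn_density_mat_1_bounds(1)]
  by (intro mult_mono mvn_density_mat_1_bounds) simp

section \<open>The two weighted averages as mixtures\<close>

lemma measurable_c_coef[measurable]: "c_coef \<beta>0 \<Omega> \<in> borel_measurable borel"
  unfolding c_coef_def by measurable

lemma measurable_d_coef[measurable]: "d_coef \<beta>0 \<Omega> \<in> borel_measurable borel"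
proof -
  have "a_vec \<beta> \<bullet> x = \<beta> * x $ 1 + x $ 2" for \<beta> and x :: "real ^ 2"
    by (simp add: a_vec_def inner_vec_def sum_2)
  then show ?thesis unfolding d_coef_def by simp
qed

context
  fixes \<Omega> :: "real ^ 2 ^ 2" and \<Phi> S R :: "real ^ 'k ^ 'k" and \<beta>0 :: real
  assumes \<Omega>: "sym_pos_def \<Omega>" and \<Phi>: "sym_pos_def \<Phi>"
    and S: "sym_pos_def S" "S ** S = \<Phi>" and R: "sym_pos_def R" "S ** R = mat 1" "R ** S = mat 1"
    "R ** R = matrix_inv \<Phi>"
begin

lemmas joint_density_eq = joint_density_kron[OF \<Omega> \<Phi> S R]

lemma measurable_joint_density:
  "(\<lambda>(\<beta>, \<mu>). joint_density \<beta>0 (kron \<Omega> \<Phi>) \<beta> \<mu> s t) \<in> borel_measurable (borel \<Otimes>\<^sub>M borel)"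
  unfolding joint_density_eq by measurable

lemma mvn_scaled_Phi:
  assumes "0 < r"
  shows "mvn 0 (r *\<^sub>R \<Phi>) = distr std_mvn borel (\<lambda>w. sqrt r *\<^sub>R (S *v w))"
proof -
  have "(sqrt r *\<^sub>R S) ** (sqrt r *\<^sub>R S) = r *\<^sub>R \<Phi>"
    using assms S(2) by (simp add: matrix_scalar_ac scalar_matrix_assoc[symmetric])
  moreover have "sym_pos_def (sqrt r *\<^sub>R S)"
    using assms S(1) by (simp add: sym_pos_def_scaleR)
  moreover have "(*v) (sqrt r *\<^sub>R S) = (\<lambda>w. sqrt r *\<^sub>R (S *v w))"
    by (simp add: fun_eq_iff scaleR_matrix_vector_assoc)
  ultimately show ?thesis
    using mvn_eq_distr_std_mvn[of "sqrt r *\<^sub>R S"] by simp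
qed

text \<open>Writing \<open>\<mu> = x S w\<close> with \<open>w\<close> standard normal removes \<open>\<Phi>\<close>, because \<open>R S = 1\<close>.\<close>

lemma joint_density_whitened:
  "joint_density \<beta>0 (kron \<Omega> \<Phi>) \<beta> (x *\<^sub>R (S *v w)) s t =
    mvn_density ((c_coef \<beta>0 \<Omega> \<beta> * x) *\<^sub>R w) (mat 1) s * mvn_density ((d_coef \<beta>0 \<Omega> \<beta> * x) *\<^sub>R w) (mat 1) t"
  by (simp add: joint_density_eq matrix_vector_mult_scaleR matrix_vector_mul_assoc R)

lemma h_MM1_eq:
  assumes "0 < \<sigma>\<^sup>2"
  shows "h_MM1 \<beta>0 (kron \<Omega> \<Phi>) \<Phi> \<sigma> s t =
    (\<integral>\<beta>. std_mixture (c_coef \<beta>0 \<Omega> \<beta> * \<bar>\<sigma>\<bar>) (d_coef \<beta>0 \<Omega> \<beta> * \<bar>\<sigma>\<bar>) s t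
      \<partial>density lborel (normal_density \<beta>0 1))"
proof -
  let ?P = "density lborel (normal_density \<beta>0 1)"
  let ?N = "mvn 0 (\<sigma>\<^sup>2 *\<^sub>R \<Phi>)"
  let ?f = "\<lambda>\<beta> \<mu>. joint_density \<beta>0 (kron \<Omega> \<Phi>) \<beta> \<mu> s t"
  have N: "?N = distr std_mvn borel (\<lambda>w. \<bar>\<sigma>\<bar> *\<^sub>R (S *v w))"
    using mvn_scaled_Phi[OF assms] by simp
  interpret P: prob_space ?P by (rule prob_space_normal_density) simp
  interpret N: prob_space ?N
    unfolding N by (rule std_mvn.prob_space_distr) simp
  interpret PN: pair_prob_space ?P ?N ..
  have [measurable_cong]: "sets ?P = sets borel" "sets ?N = sets borel"
    by (simp_all add: N)
  have meas: "case_prod ?f \<in> borel_measurable (?P \<Otimes>\<^sub>M ?N)"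
    using measurable_joint_density[of s t] by (simp cong: measurable_cong_sets)
  have "integrable (?P \<Otimes>\<^sub>M ?N) (case_prod ?f)"
    using mvn_density_product_bound[of _ s _ t]
    by (intro PN.integrable_const_bound[OF _ meas] AE_I2) (auto simp: joint_density_eq)
  then have "h_MM1 \<beta>0 (kron \<Omega> \<Phi>) \<Phi> \<sigma> s t = (\<integral>\<beta>. \<integral>\<mu>. ?f \<beta> \<mu> \<partial>?N \<partial>?P)"
    unfolding h_MM1_def weighted_density_def MM1_law_def using PN.integral_fst'[of "case_prod ?f"] by simp
  also have "\<dots> = (\<integral>\<beta>. std_mixture (c_coef \<beta>0 \<Omega> \<beta> * \<bar>\<sigma>\<bar>) (d_coef \<beta>0 \<Omega> \<beta> * \<bar>\<sigma>\<bar>) s t \<partial>?P)"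
  proof (rule Bochner_Integration.integral_cong[OF refl])
    fix \<beta>
    have "?f \<beta> \<in> borel_measurable borel"
      unfolding joint_density_eq by measurable
    then show "(\<integral>\<mu>. ?f \<beta> \<mu> \<partial>?N) = std_mixture (c_coef \<beta>0 \<Omega> \<beta> * \<bar>\<sigma>\<bar>) (d_coef \<beta>0 \<Omega> \<beta> * \<bar>\<sigma>\<bar>) s t"
      unfolding N by (simp add: integral_distr joint_density_whitened std_mixture_def)
  qed
  finally show ?thesis .
qed

text \<open>As functions of \<open>\<beta>\<close>, the two coefficients parametrize a line in the plane. It misses the origin, as
  \<open>d\<close> equals \<open>u > 0\<close> where \<open>c = 0\<close>; so a direction that is not parallel to it determines \<open>\<beta>\<close>.\<close>

lemma coef_forms:
  obtains \<kappa> u e where "0 < \<kappa>" "0 < u" "\<And>\<beta>. c_coef \<beta>0 \<Omega> \<beta> = (\<beta> - \<beta>0) * \<kappa>"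
    "\<And>\<beta>. d_coef \<beta>0 \<Omega> \<beta> = u + (\<beta> - \<beta>0) * e"
proof -
  define \<kappa> where "\<kappa> = (b_vec \<beta>0 \<bullet> (\<Omega> *v b_vec \<beta>0)) powr (- 1 / 2)"
  define y where "y = matrix_inv \<Omega> *v a_vec \<beta>0"
  define x where "x = a_vec \<beta>0 \<bullet> y"
  have "0 < b_vec \<beta>0 \<bullet> (\<Omega> *v b_vec \<beta>0)" "0 < x"
    unfolding x_def y_def
    by (intro sym_pos_def_pos sym_pos_def_matrix_inv(1) \<Omega> a_vec_nonzero b_vec_nonzero)+
  then have "0 < \<kappa>" "0 < x * x powr (- 1 / 2)"
    by (simp_all add: \<kappa>_def)
  moreover have "c_coef \<beta>0 \<Omega> \<beta> = (\<beta> - \<beta>0) * \<kappa>" for \<beta>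
    by (simp add: c_coef_def \<kappa>_def)
  moreover have "d_coef \<beta>0 \<Omega> \<beta> = x * x powr (- 1 / 2) + (\<beta> - \<beta>0) * (y $ 1 * x powr (- 1 / 2))" for \<beta>
  proof -
    have "a_vec \<beta> \<bullet> y = x + (\<beta> - \<beta>0) * y $ 1"
      by (simp add: x_def a_vec_def inner_vec_def sum_2 algebra_simps)
    then show ?thesis
      unfolding d_coef_def y_def[symmetric] x_def[symmetric] by (simp only: distrib_right mult.assoc)
  qed
  ultimately show ?thesis using that by blast
qed

lemma l_vec_norm: "(norm (l_vec \<beta>0 \<Omega> \<beta>))\<^sup>2 = (c_coef \<beta>0 \<Omega> \<beta>)\<^sup>2 + (d_coef \<beta>0 \<Omega> \<beta>)\<^sup>2"
  unfolding power2_norm_eq_inner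
  by (simp add: l_vec_def inner_vec_def sum_2 power2_eq_square)

lemma l_vec_norm_pos: "0 < (norm (l_vec \<beta>0 \<Omega> \<beta>))\<^sup>2"
proof -
  obtain \<kappa> u e where "0 < \<kappa>" "0 < u" "\<And>\<beta>. c_coef \<beta>0 \<Omega> \<beta> = (\<beta> - \<beta>0) * \<kappa>"
    "\<And>\<beta>. d_coef \<beta>0 \<Omega> \<beta> = u + (\<beta> - \<beta>0) * e"
    using coef_forms by blast
  then show ?thesis
    unfolding l_vec_norm by (cases "\<beta> = \<beta>0") (simp_all add: add_pos_nonneg)
qed

text \<open>With \<open>p\<close> the slope of the line, \<open>tan \<theta> = d / c\<close> reads \<open>tan \<theta> = p + q / (\<beta> - \<beta>\<^sub>0)\<close>, which has no solution for
  \<open>tan \<theta> = p\<close>; there the description operator yields a fixed real number, and the explicit form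
  makes \<open>beta_of\<close> measurable.\<close>

lemma beta_of_cases:
  obtains p q where "\<And>\<theta>. beta_of \<beta>0 \<Omega> \<theta> = (if tan \<theta> = p then (THE \<beta>. False) else \<beta>0 + q / (tan \<theta> - p))"
    "\<And>\<theta>. tan \<theta> \<noteq> p \<Longrightarrow> c_coef \<beta>0 \<Omega> (beta_of \<beta>0 \<Omega> \<theta>) \<noteq> 0 \<and>
      d_coef \<beta>0 \<Omega> (beta_of \<beta>0 \<Omega> \<theta>) = tan \<theta> * c_coef \<beta>0 \<Omega> (beta_of \<beta>0 \<Omega> \<theta>)"
proof -
  obtain \<kappa> u e where \<kappa>: "0 < \<kappa>" and u: "0 < u" and c: "\<And>\<beta>. c_coef \<beta>0 \<Omega> \<beta> = (\<beta> - \<beta>0) * \<kappa>"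
    and d: "\<And>\<beta>. d_coef \<beta>0 \<Omega> \<beta> = u + (\<beta> - \<beta>0) * e"
    using coef_forms by blast
  define p q where "p = e / \<kappa>" and "q = u / \<kappa>"
  have q: "0 < q" using \<kappa> u by (simp add: q_def)
  have iff: "c_coef \<beta>0 \<Omega> \<beta> \<noteq> 0 \<and> x = d_coef \<beta>0 \<Omega> \<beta> / c_coef \<beta>0 \<Omega> \<beta> \<longleftrightarrow>
      x \<noteq> p \<and> \<beta> = \<beta>0 + q / (x - p)" for \<beta> x
  proof (cases "\<beta> = \<beta>0")
    case True
    then show ?thesis using q by (auto simp: c)
  next
    case False
    have "d_coef \<beta>0 \<Omega> \<beta> / c_coef \<beta>0 \<Omega> \<beta> = p + q / (\<beta> - \<beta>0)"
      using False \<kappa> by (simp add: c d p_def q_def field_simps)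
    moreover have "x = p + q / (\<beta> - \<beta>0) \<longleftrightarrow> x \<noteq> p \<and> \<beta> - \<beta>0 = q / (x - p)"
      using False q by (cases "x = p") (auto simp: field_simps)
    ultimately show ?thesis
      using False \<kappa> by (auto simp: c)
  qed
  have form: "beta_of \<beta>0 \<Omega> \<theta> = (if tan \<theta> = p then (THE \<beta>. False) else \<beta>0 + q / (tan \<theta> - p))" for \<theta>
    unfolding beta_of_def iff by simp
  show ?thesis
  proof (rule that[OF form])
    fix \<theta> assume "tan \<theta> \<noteq> p"
    then have "tan \<theta> \<noteq> p \<and> beta_of \<beta>0 \<Omega> \<theta> = \<beta>0 + q / (tan \<theta> - p)"
      by (simp add: form)
    then show "c_coef \<beta>0 \<Omega> (beta_of \<beta>0 \<Omega> \<theta>) \<noteq> 0 \<and>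
      d_coef \<beta>0 \<Omega> (beta_of \<beta>0 \<Omega> \<theta>) = tan \<theta> * c_coef \<beta>0 \<Omega> (beta_of \<beta>0 \<Omega> \<theta>)"
      unfolding iff[symmetric] by simp
  qed
qed

lemma measurable_beta_of[measurable]: "beta_of \<beta>0 \<Omega> \<in> borel_measurable borel"
proof -
  obtain p q where "\<And>\<theta>. beta_of \<beta>0 \<Omega> \<theta> = (if tan \<theta> = p then (THE \<beta>. False) else \<beta>0 + q / (tan \<theta> - p))"
    using beta_of_cases by metis
  then have "beta_of \<beta>0 \<Omega> = (\<lambda>\<theta>. if tan \<theta> = p then (THE \<beta>. False) else \<beta>0 + q / (tan \<theta> - p))"
    by blast
  moreover have [measurable]: "(tan :: real \<Rightarrow> real) \<in> borel_measurable borel"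
    unfolding tan_def by measurable
  ultimately show ?thesis by simp
qed

text \<open>The defining equation of \<open>\<beta>(\<theta>)\<close> says that \<open>l\<^sub>\<beta>\<close> is a multiple of \<open>(cos \<theta>, sin \<theta>)\<close>, so normalizing it
  gives \<open>\<plusminus>(cos \<theta>, sin \<theta>)\<close>. The sign is not determined, which is why only squares and the product
  are compared. The excluded angles, where \<open>cos \<theta> = 0\<close> or \<open>tan \<theta> = p\<close>, are countably many.\<close>

lemma AE_polar_form:
  "AE \<theta> in lborel. let \<beta> = beta_of \<beta>0 \<Omega> \<theta>; c = c_coef \<beta>0 \<Omega> \<beta>; d = d_coef \<beta>0 \<Omega> \<beta> in
    c\<^sup>2 / (norm (l_vec \<beta>0 \<Omega> \<beta>))\<^sup>2 = (cos \<theta>)\<^sup>2 \<and>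
    d\<^sup>2 / (norm (l_vec \<beta>0 \<Omega> \<beta>))\<^sup>2 = (sin \<theta>)\<^sup>2 \<and>
    c * d / (norm (l_vec \<beta>0 \<Omega> \<beta>))\<^sup>2 = cos \<theta> * sin \<theta>"
proof -
  obtain p where p: "\<And>\<theta>. tan \<theta> \<noteq> p \<Longrightarrow> c_coef \<beta>0 \<Omega> (beta_of \<beta>0 \<Omega> \<theta>) \<noteq> 0 \<and>
      d_coef \<beta>0 \<Omega> (beta_of \<beta>0 \<Omega> \<theta>) = tan \<theta> * c_coef \<beta>0 \<Omega> (beta_of \<beta>0 \<Omega> \<theta>)"
    using beta_of_cases by metis
  let ?E = "range (\<lambda>i::int. pi / 2 + of_int i * pi) \<union> range (\<lambda>i::int. arctan p + of_int i * pi)"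
  have shift: "\<theta> \<in> range (\<lambda>i::int. x + of_int i * pi)" if "sin (\<theta> - x) = 0" for x \<theta> :: real
    using that unfolding sin_zero_iff_int2 by (auto simp: algebra_simps)
  have "?E \<in> null_sets lborel"
    by (intro countable_imp_null_set_lborel) auto
  moreover have "\<theta> \<in> ?E" if "cos \<theta> = 0 \<or> tan \<theta> = p" for \<theta>
  proof (cases "cos \<theta> = 0")
    case True
    then show ?thesis using shift[of \<theta> "pi / 2"] by (simp add: sin_diff)
  next
    case False
    with that have "sin \<theta> / cos \<theta> = sin (arctan p) / cos (arctan p)"
      using tan_arctan[of p] by (simp add: tan_def)
    with False have "sin (\<theta> - arctan p) = 0"
      by (simp add: sin_diff field_simps)
    then show ?thesis using shift by blast
  qed
  ultimately have "AE \<theta> in lborel. cos \<theta> \<noteq> 0 \<and> tan \<theta> \<noteq> p"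
    by (intro AE_I'[of ?E]) auto
  then show ?thesis
  proof eventually_elim
    case (elim \<theta>)
    define c where "c = c_coef \<beta>0 \<Omega> (beta_of \<beta>0 \<Omega> \<theta>)"
    have c: "c \<noteq> 0" "d_coef \<beta>0 \<Omega> (beta_of \<beta>0 \<Omega> \<theta>) = tan \<theta> * c"
      using p[of \<theta>] elim by (auto simp: c_def)
    have "(norm (l_vec \<beta>0 \<Omega> (beta_of \<beta>0 \<Omega> \<theta>)))\<^sup>2 = c\<^sup>2 * (1 + (tan \<theta>)\<^sup>2)"
      by (simp add: l_vec_norm c c_def[symmetric] power_mult_distrib algebra_simps)
    also have "\<dots> = c\<^sup>2 / (cos \<theta>)\<^sup>2"
      using elim tan_sec[of \<theta>] by (simp add: divide_inverse power_inverse)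
    finally have l: "(norm (l_vec \<beta>0 \<Omega> (beta_of \<beta>0 \<Omega> \<theta>)))\<^sup>2 = c\<^sup>2 / (cos \<theta>)\<^sup>2" .
    show ?case
      unfolding Let_def l c(2) c_def[symmetric]
      using c(1) elim by (simp add: tan_def field_simps power2_eq_square)
  qed
qed

text \<open>The scaling of \<open>\<mu>\<close> by the inverse norm of \<open>l\<^sub>\<beta>\<close> normalizes \<open>(c\<^sub>\<beta>, d\<^sub>\<beta>)\<close>, and by the polar form the
  result may be replaced by \<open>\<surd>\<zeta> (cos \<theta>, sin \<theta>)\<close>: the undetermined sign does not change the mixture.
  All dependence on \<open>\<Omega>\<close> and \<open>\<beta>\<^sub>0\<close> disappears.\<close>

lemma h_MM2_eq:
  assumes \<zeta>: "0 < \<zeta>"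
  shows "h_MM2 \<beta>0 (kron \<Omega> \<Phi>) \<Omega> \<Phi> \<zeta> s t =
    (\<integral>\<theta>. std_mixture (sqrt \<zeta> * cos \<theta>) (sqrt \<zeta> * sin \<theta>) s t \<partial>uniform_measure lborel {- pi..pi})"
proof -
  let ?U = "uniform_measure lborel {- pi..pi}"
  define b where "b = beta_of \<beta>0 \<Omega>"
  define r where "r \<theta> = \<zeta> / (norm (l_vec \<beta>0 \<Omega> (b \<theta>)))\<^sup>2" for \<theta>
  let ?B = "borel \<Otimes>\<^sub>M borel :: (real \<times> (real ^ 'k)) measure"
  let ?g = "\<lambda>\<theta> w. (b \<theta>, sqrt (r \<theta>) *\<^sub>R (S *v w))"
  let ?f = "\<lambda>(\<beta>, \<mu>). joint_density \<beta>0 (kron \<Omega> \<Phi>) \<beta> \<mu> s t"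
  have b[measurable]: "b \<in> borel_measurable borel"
    by (simp add: b_def)
  have r[measurable]: "r \<in> borel_measurable borel"
    unfolding r_def l_vec_norm by measurable
  have r_pos: "0 < r \<theta>" for \<theta>
    using \<zeta> l_vec_norm_pos by (simp add: r_def)
  have kernel: "mvn 0 (r \<theta> *\<^sub>R \<Phi>) \<bind> (\<lambda>\<mu>. return ?B (b \<theta>, \<mu>)) = distr std_mvn ?B (?g \<theta>)" for \<theta>
    unfolding mvn_scaled_Phi[OF r_pos] by (subst bind_distr_return[where N=borel]) auto
  have law: "MM2_law \<beta>0 \<Omega> \<Phi> \<zeta> = ?U \<bind> (\<lambda>\<theta>. distr std_mvn ?B (?g \<theta>))"
    unfolding MM2_law_def b_def[symmetric] r_def[symmetric] kernel ..
  have U: "prob_space ?U"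
    by (rule prob_space_uniform_measure) auto
  have "(\<lambda>\<theta>. distr std_mvn ?B (?g \<theta>)) \<in> ?U \<rightarrow>\<^sub>M prob_algebra ?B"
  proof (rule measurable_distr_prob_space2)
    show "(\<lambda>\<theta>. std_mvn) \<in> ?U \<rightarrow>\<^sub>M prob_algebra (borel :: (real ^ 'k) measure)"
      by (rule measurable_const) (simp add: space_prob_algebra prob_space_std_mvn)
  qed measurable
  then have meas: "(\<lambda>\<theta>. distr std_mvn ?B (?g \<theta>)) \<in> ?U \<rightarrow>\<^sub>M subprob_algebra ?B"
    by (rule measurable_prob_algebraD)
  have g[measurable]: "?g \<theta> \<in> std_mvn \<rightarrow>\<^sub>M ?B" for \<theta>
    by measurable
  have "h_MM2 \<beta>0 (kron \<Omega> \<Phi>) \<Omega> \<Phi> \<zeta> s t = (\<integral>\<theta>. integral\<^sup>L (distr std_mvn ?B (?g \<theta>)) ?f \<partial>?U)"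
    unfolding h_MM2_def weighted_density_def law
  proof (rule integral_bind[OF measurable_joint_density _ meas])
    show "\<bar>?f x\<bar> \<le> (1 / sqrt ((2 * pi) ^ CARD('k))) * (1 / sqrt ((2 * pi) ^ CARD('k)))" for x
      using mvn_density_product_bound by (auto simp: joint_density_eq split: prod.split)
    show "finite_measure ?U"
      using U by (simp add: prob_space.finite_measure)
    have "prob_space (distr std_mvn ?B (?g \<theta>))" for \<theta>
      by (rule std_mvn.prob_space_distr) measurable
    from prob_space.emeasure_space_1[OF this]
    show "AE \<theta> in ?U. emeasure (distr std_mvn ?B (?g \<theta>)) (space (distr std_mvn ?B (?g \<theta>))) \<le> ennreal 1"
      by (intro AE_I2) (simp only: ennreal_1 order_refl)
  qed
  also have "\<dots> = (\<integral>\<theta>. std_mixture (c_coef \<beta>0 \<Omega> (b \<theta>) * sqrt (r \<theta>)) (d_coef \<beta>0 \<Omega> (b \<theta>) * sqrt (r \<theta>)) s t \<partial>?U)"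
    unfolding std_mixture_def
    by (intro Bochner_Integration.integral_cong refl, subst integral_distr[OF g measurable_joint_density])
      (simp add: joint_density_whitened)
  also have "\<dots> = (\<integral>\<theta>. std_mixture (sqrt \<zeta> * cos \<theta>) (sqrt \<zeta> * sin \<theta>) s t \<partial>?U)"
  proof (rule integral_cong_AE)
    have "AE \<theta> in lborel. std_mixture (c_coef \<beta>0 \<Omega> (b \<theta>) * sqrt (r \<theta>)) (d_coef \<beta>0 \<Omega> (b \<theta>) * sqrt (r \<theta>)) s t
        = std_mixture (sqrt \<zeta> * cos \<theta>) (sqrt \<zeta> * sin \<theta>) s t"
      using AE_polar_form
    proof eventually_elim
      case (elim \<theta>)
      define c d l where "c = c_coef \<beta>0 \<Omega> (b \<theta>)" and "d = d_coef \<beta>0 \<Omega> (b \<theta>)"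
        and "l = (norm (l_vec \<beta>0 \<Omega> (b \<theta>)))\<^sup>2"
      have polar: "c\<^sup>2 / l = (cos \<theta>)\<^sup>2" "d\<^sup>2 / l = (sin \<theta>)\<^sup>2" "c * d / l = cos \<theta> * sin \<theta>"
        using elim by (simp_all add: Let_def c_def d_def l_def b_def)
      have sqrt_sq: "sqrt (r \<theta>) * sqrt (r \<theta>) = \<zeta> / l" "sqrt \<zeta> * sqrt \<zeta> = \<zeta>"
        using r_pos[of \<theta>] \<zeta> by (simp_all add: r_def l_def)
      show ?case
        unfolding c_def[symmetric] d_def[symmetric]
      proof (rule std_mixture_cong)
        have rearrange: "(x * q) * (y * q) = (q * q) * (x * y)" "(q * x) * (q * y) = (q * q) * (x * y)"
          for x y q :: real
          by (simp_all only: mult_ac)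
        have "(x * sqrt (r \<theta>)) * (y * sqrt (r \<theta>)) = \<zeta> * (x * y / l)" for x y
          using rearrange(1)[of x "sqrt (r \<theta>)" y] unfolding sqrt_sq by simp
        moreover have "(sqrt \<zeta> * x) * (sqrt \<zeta> * y) = \<zeta> * (x * y)" for x y
          using rearrange(2)[of "sqrt \<zeta>" x y] unfolding sqrt_sq .
        ultimately show "(c * sqrt (r \<theta>))\<^sup>2 = (sqrt \<zeta> * cos \<theta>)\<^sup>2" "(d * sqrt (r \<theta>))\<^sup>2 = (sqrt \<zeta> * sin \<theta>)\<^sup>2"
          "c * sqrt (r \<theta>) * (d * sqrt (r \<theta>)) * (s \<bullet> t) = sqrt \<zeta> * cos \<theta> * (sqrt \<zeta> * sin \<theta>) * (s \<bullet> t)"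
          using polar by (simp_all only: power2_eq_square)
      qed simp_all
    qed
    then show "AE \<theta> in ?U. std_mixture (c_coef \<beta>0 \<Omega> (b \<theta>) * sqrt (r \<theta>)) (d_coef \<beta>0 \<Omega> (b \<theta>) * sqrt (r \<theta>)) s t
        = std_mixture (sqrt \<zeta> * cos \<theta>) (sqrt \<zeta> * sin \<theta>) s t"
      by (intro AE_uniform_measureI) auto
  qed measurable
  finally show ?thesis .
qed

end

section \<open>Invariance\<close>

lemma uniform_measure_symmetric_interval_reflect:
  fixes a :: real
  shows "distr (uniform_measure lborel {- a..a}) borel uminus = uniform_measure lborel {- a..a}"
proof (rule measure_eqI)
  fix X assume "X \<in> sets (distr (uniform_measure lborel {- a..a}) borel uminus)"
  then have X[measurable]: "X \<in> sets borel" by simp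
  have "emeasure lborel ({- a..a} \<inter> uminus -` X) = emeasure lborel (uminus -` ({- a..a} \<inter> X))"
    by (rule arg_cong[of _ _ "emeasure lborel"]) auto
  also have "\<dots> = emeasure (distr lborel borel uminus) ({- a..a} \<inter> X)"
    by (simp add: emeasure_distr)
  also have "\<dots> = emeasure lborel ({- a..a} \<inter> X)"
    by (simp only: lborel_distr_uminus)
  finally have "emeasure lborel ({- a..a} \<inter> uminus -` X) = emeasure lborel ({- a..a} \<inter> X)" .
  moreover have "uminus -` X \<in> sets borel"
    using measurable_sets_borel[OF _ X, of uminus] by simp
  ultimately show "emeasure (distr (uniform_measure lborel {- a..a}) borel uminus) X
      = emeasure (uniform_measure lborel {- a..a}) X"
    by (simp add: emeasure_distr)
qed simp

text \<open>\<open>F\<close> is the identity for dependence on the Gram entries themselves and the absolute value for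
  dependence up to the sign of \<open>s \<bullet> t\<close>.\<close>

lemma factors_through_gram:
  fixes h :: "real ^ 'k \<Rightarrow> real ^ 'k \<Rightarrow> real"
  assumes "\<And>s t s' t'. s' \<bullet> s' = s \<bullet> s \<Longrightarrow> F (s' \<bullet> t') = F (s \<bullet> t) \<Longrightarrow> t' \<bullet> t' = t \<bullet> t \<Longrightarrow> h s' t' = h s t"
  shows "\<exists>H. \<forall>s t. h s t = H (s \<bullet> s) (F (s \<bullet> t)) (t \<bullet> t)"
proof -
  let ?H = "\<lambda>a b c. SOME y. \<exists>s t. s \<bullet> s = a \<and> F (s \<bullet> t) = b \<and> t \<bullet> t = c \<and> y = h s t"
  have "h s t = ?H (s \<bullet> s) (F (s \<bullet> t)) (t \<bullet> t)" for s t
  proof (rule some_equality[symmetric])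
    fix y assume "\<exists>s' t'. s' \<bullet> s' = s \<bullet> s \<and> F (s' \<bullet> t') = F (s \<bullet> t) \<and> t' \<bullet> t' = t \<bullet> t \<and> y = h s' t'"
    then show "y = h s t" by (auto intro: assms)
  qed blast
  then show ?thesis by (intro exI[of _ ?H]) blast
qed

theorem proposition1:
  fixes \<beta>0 \<sigma> \<zeta> :: real
    and \<Sigma> :: "real ^ (2 \<times> 'k::finite) ^ (2 \<times> 'k)"
    and \<Omega> :: "real ^ 2 ^ 2"
    and \<Phi> :: "real ^ 'k ^ 'k"
  assumes "sym_pos_def \<Sigma>"
    and "sym_pos_def \<Omega>"
    and "sym_pos_def \<Phi>"
    and "\<Sigma> = kron \<Omega> \<Phi>"
    and "0 < \<sigma>\<^sup>2"
    and "0 < \<zeta>"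
  shows
    "(\<forall>g s t. orthogonal_matrix g \<longrightarrow>
        h_MM1 \<beta>0 \<Sigma> \<Phi> \<sigma> (g *v s) (g *v t) = h_MM1 \<beta>0 \<Sigma> \<Phi> \<sigma> s t)
     \<and> (\<exists>H. \<forall>s t. h_MM1 \<beta>0 \<Sigma> \<Phi> \<sigma> s t = H (s \<bullet> s) (s \<bullet> t) (t \<bullet> t))
     \<and> (\<forall>g s t. orthogonal_matrix g \<longrightarrow>
        h_MM2 \<beta>0 \<Sigma> \<Omega> \<Phi> \<zeta> (g *v s) (g *v t) = h_MM2 \<beta>0 \<Sigma> \<Omega> \<Phi> \<zeta> s t)
     \<and> (\<exists>H. \<forall>s t. h_MM2 \<beta>0 \<Sigma> \<Omega> \<Phi> \<zeta> s t = H (s \<bullet> s) (s \<bullet> t) (t \<bullet> t))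
     \<and> (\<forall>s t s' t'. s' \<bullet> s' = s \<bullet> s \<and> s' \<bullet> t' = - (s \<bullet> t) \<and> t' \<bullet> t' = t \<bullet> t \<longrightarrow>
        h_MM2 \<beta>0 \<Sigma> \<Omega> \<Phi> \<zeta> s' t' = h_MM2 \<beta>0 \<Sigma> \<Omega> \<Phi> \<zeta> s t)
     \<and> (\<exists>H. \<forall>s t. h_MM2 \<beta>0 \<Sigma> \<Omega> \<Phi> \<zeta> s t = H (s \<bullet> s) \<bar>s \<bullet> t\<bar> (t \<bullet> t))"
proof -
  obtain S R where SR: "sym_pos_def S" "S ** S = \<Phi>" "sym_pos_def R" "S ** R = mat 1" "R ** S = mat 1"
    "R ** R = matrix_inv \<Phi>"
    using sym_pos_def_square_root[OF assms(3)] by blast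
  note MM1 = h_MM1_eq[OF assms(2,3) SR assms(5), of \<beta>0, folded assms(4)]
  note MM2 = h_MM2_eq[OF assms(2,3) SR assms(6), of \<beta>0, folded assms(4)]
  have h1: "h_MM1 \<beta>0 \<Sigma> \<Phi> \<sigma> s' t' = h_MM1 \<beta>0 \<Sigma> \<Phi> \<sigma> s t"
    if "s' \<bullet> s' = s \<bullet> s" "s' \<bullet> t' = s \<bullet> t" "t' \<bullet> t' = t \<bullet> t" for s t s' t'
    unfolding MM1 by (intro Bochner_Integration.integral_cong refl std_mixture_cong) (simp_all add: that)
  have h2: "h_MM2 \<beta>0 \<Sigma> \<Omega> \<Phi> \<zeta> s' t' = h_MM2 \<beta>0 \<Sigma> \<Omega> \<Phi> \<zeta> s t"
    if "s' \<bullet> s' = s \<bullet> s" "s' \<bullet> t' = s \<bullet> t" "t' \<bullet> t' = t \<bullet> t" for s t s' t'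
    unfolding MM2 by (intro Bochner_Integration.integral_cong refl std_mixture_cong) (simp_all add: that)
  have h2_sign: "h_MM2 \<beta>0 \<Sigma> \<Omega> \<Phi> \<zeta> s' t' = h_MM2 \<beta>0 \<Sigma> \<Omega> \<Phi> \<zeta> s t"
    if "s' \<bullet> s' = s \<bullet> s" "s' \<bullet> t' = - (s \<bullet> t)" "t' \<bullet> t' = t \<bullet> t" for s t s' t'
  proof -
    let ?U = "uniform_measure lborel {- pi..pi}"
    \<comment> \<open>The reflection \<open>\<theta> \<mapsto> -\<theta>\<close> flips the sign of \<open>cos \<theta> sin \<theta>\<close> and so undoes that of \<open>s \<bullet> t\<close>.\<close>
    have "h_MM2 \<beta>0 \<Sigma> \<Omega> \<Phi> \<zeta> s' t' =
      (\<integral>\<theta>. std_mixture (sqrt \<zeta> * cos (- \<theta>)) (sqrt \<zeta> * sin (- \<theta>)) s t \<partial>?U)"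
      unfolding MM2 by (intro Bochner_Integration.integral_cong refl std_mixture_cong) (simp_all add: that)
    also have "\<dots> = (\<integral>\<theta>. std_mixture (sqrt \<zeta> * cos \<theta>) (sqrt \<zeta> * sin \<theta>) s t \<partial>distr ?U borel uminus)"
      by (rule integral_distr[symmetric]) measurable
    finally show ?thesis
      unfolding MM2 uniform_measure_symmetric_interval_reflect .
  qed
  have gram: "(g *v x) \<bullet> (g *v y) = x \<bullet> y" if "orthogonal_matrix g" for g :: "real ^ 'k ^ 'k" and x y
  proof -
    have "orthogonal_transformation ((*v) g)"
      using that by (simp add: orthogonal_transformation_matrix)
    then show ?thesis by (simp add: orthogonal_transformation_def)
  qed
  show ?thesis
  proof (intro conjI allI impI)
    show "\<exists>H. \<forall>s t. h_MM1 \<beta>0 \<Sigma> \<Phi> \<sigma> s t = H (s \<bullet> s) (s \<bullet> t) (t \<bullet> t)"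
      by (rule factors_through_gram[where F = "\<lambda>x. x"]) (rule h1)
    show "\<exists>H. \<forall>s t. h_MM2 \<beta>0 \<Sigma> \<Omega> \<Phi> \<zeta> s t = H (s \<bullet> s) (s \<bullet> t) (t \<bullet> t)"
      by (rule factors_through_gram[where F = "\<lambda>x. x"]) (rule h2)
    show "\<exists>H. \<forall>s t. h_MM2 \<beta>0 \<Sigma> \<Omega> \<Phi> \<zeta> s t = H (s \<bullet> s) \<bar>s \<bullet> t\<bar> (t \<bullet> t)"
      by (rule factors_through_gram[where F = abs]) (metis abs_eq_iff h2 h2_sign)
  qed (auto intro: h1 h2 h2_sign simp: gram)
qed

end
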